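(* Suppose $g\in H^t(\mathbb U)$, $t\ge1$, with $\min_{z\in\mathbb U}|g(z)|>0$, and assume the Riemann--Hilbert problem with jump $g$ has a unique solution of the form $\phi=1+\mathcal Cu$ with $u\in H^t(\mathbb U)$. Then for every $s\in\{0\}\cup(1/2,\infty)$ with $0\le2s<t$, there exists $N_0>0$ such that for $N>N_0$ the operator $\mathcal C^+-\mathcal M_N(g)\mathcal C^-$ is invertible on $\operatorname{ran}\mathcal P_N$, and the unique solution $u_N\in\operatorname{ran}\mathcal P_N$ of $$(\mathcal C^+-\mathcal M_N(g)\mathcal C^-)u_N=\mathcal P_N(g-1)$$ satisfies $\|u-u_N\|_s\le C_{s,t}N^{s-t}$ for a constant $C_{s,t}$ independent of $N$.
   Context: $\mathbb U=\{|z|=1\}$, positively oriented. $u\in L^2(\mathbb U)$ has Laurent coefficients $u_j$, $u(z)=\sum_ju_jz^j$; $H^s(\mathbb U)$ has norm $\|u\|_s^2=c_{|s|}\sum_j|u_j|^2\max\{1,|j|\}^{2s}$ with fixed normalization constants $c_{|s|}>0$. Cauchy operator $\mathcal Cu(z)=\frac1{2\pi i}\oint_{\mathbb U}\frac{u(z')}{z'-z}dz'$, boundary values $\mathcal C^\pm u(z)=\lim_{\epsilon\to0^+}\mathcal Cu(z(1\mp\epsilon))$, i.e. $\mathcal C^+u=\sum_{j\ge0}u_jz^j$, $\mathcal C^-u=-\sum_{j<0}u_jz^j$. The Riemann--Hilbert problem with jump $g$: find $\phi$ analytic on $\mathbb C\setminus\mathbb U$ of the form $\phi=1+\mathcal Cu$,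 $u\in L^2(\mathbb U)$, with $\phi^+=\phi^-g$ a.e. on $\mathbb U$, where $\phi^\pm(z)=\lim_{\epsilon\to0^+}\phi(z(1\mp\epsilon))$ (equivalently $\mathcal C^+u-(\mathcal C^-u)g=g-1$). $\mathcal M(g)u=gu$. For $N\ge1$, $N_-=\lfloor N/2\rfloor$, $N_+=\lfloor(N-1)/2\rfloor$, $\mathcal P_Nu=\sum_{j=-N_-}^{N_+}u_jz^j$, and $\mathcal M_N(g)=\mathcal P_N\mathcal M(g)\mathcal P_N$. *)

theory Defs
  imports "HOL-Analysis.Analysis"
begin

text \<open>Functions on the unit circle are represented by their Laurent
  coefficient sequences  u :: int => complex, u(z) = sum_j u_j z^j.\<close>

type_synonym lcoef = "int \<Rightarrow> complex"

definition in_Hs :: "real \<Rightarrow> lcoef \<Rightarrow> bool" where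
  "in_Hs s u \<longleftrightarrow>
     (\<lambda>j. (cmod (u j))\<^sup>2 * (max 1 \<bar>real_of_int j\<bar>) powr (2 * s)) summable_on UNIV"

text \<open>H^s norm with normalization constants c (c r for r = |s|).\<close>
definition Hs_norm :: "(real \<Rightarrow> real) \<Rightarrow> real \<Rightarrow> lcoef \<Rightarrow> real" where
  "Hs_norm c s u =
     sqrt (c \<bar>s\<bar> * (\<Sum>\<^sub>\<infinity>j\<in>UNIV. (cmod (u j))\<^sup>2 * (max 1 \<bar>real_of_int j\<bar>) powr (2 * s)))"

definition lval :: "lcoef \<Rightarrow> complex \<Rightarrow> complex" where
  "lval u z = (\<Sum>\<^sub>\<infinity>j\<in>UNIV. u j * z powi j)"

definition Cplus :: "lcoef \<Rightarrow> lcoef" where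
  "Cplus u = (\<lambda>j. if j \<ge> 0 then u j else 0)"

definition Cminus :: "lcoef \<Rightarrow> lcoef" where
  "Cminus u = (\<lambda>j. if j < 0 then - u j else 0)"

definition Mult :: "lcoef \<Rightarrow> lcoef \<Rightarrow> lcoef" where
  "Mult g u = (\<lambda>k. \<Sum>\<^sub>\<infinity>j\<in>UNIV. g j * u (k - j))"

definition one_c :: lcoef where
  "one_c = (\<lambda>j. if j = 0 then 1 else 0)"

definition RHP_sol :: "lcoef \<Rightarrow> lcoef \<Rightarrow> bool" where
  "RHP_sol g u \<longleftrightarrow> in_Hs 0 u \<and> Cplus u - Mult g (Cminus u) = g - one_c"

definition Nminus :: "nat \<Rightarrow> int" where "Nminus N = int (N div 2)"
definition Nplus :: "nat \<Rightarrow> int" where "Nplus N = (int N - 1) div 2"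

definition PN :: "nat \<Rightarrow> lcoef \<Rightarrow> lcoef" where
  "PN N u = (\<lambda>j. if - Nminus N \<le> j \<and> j \<le> Nplus N then u j else 0)"

definition ranPN :: "nat \<Rightarrow> lcoef set" where
  "ranPN N = range (PN N)"

definition MN :: "nat \<Rightarrow> lcoef \<Rightarrow> lcoef \<Rightarrow> lcoef" where
  "MN N g u = PN N (Mult g (PN N u))"

definition AN :: "nat \<Rightarrow> lcoef \<Rightarrow> lcoef \<Rightarrow> lcoef" where
  "AN N g v = Cplus v - MN N g (Cminus v)"

end

theory Submission
  imports Defs "HOL-Complex_Analysis.Great_Picard" "HOL-Library.Function_Algebras"
begin

text \<open>
  Let \<open>P\<close> and \<open>Q\<close> be the projections onto the modes \<open>j \<ge> 0\<close> and \<open>j < 0\<close>. The operator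
  \<open>\<C>\<^sup>+ - \<M>(g)\<C>\<^sup>- = P + gQ\<close> is block triangular with respect to them, so everything reduces to the
  stability in \<open>\<ell>\<^sup>2\<close> of the finite sections of the Toeplitz operator \<open>QgQ\<close>. Suppose that unit vectors
  \<open>v\<^sub>n\<close> supported in \<open>[-M\<^sub>n, -1]\<close> are almost annihilated by the sections. The pointwise limits of
  \<open>v\<^sub>n\<close> seen from the two ends of the window lie in the kernels of \<open>QgQ\<close> and of its transpose. The first
  kernel is trivial by uniqueness for the Riemann--Hilbert problem, the second because the problem has
  a solution. Hence the mass of \<open>v\<^sub>n\<close> escapes from both ends, so \<open>g v\<^sub>n\<close> is close to its section and tends
  to \<open>0\<close> in norm, contradicting \<open>\<parallel>g v\<parallel> \<ge> \<delta> \<parallel>v\<parallel>\<close>.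

  Stability in \<open>\<ell>\<^sup>2\<close> already gives the rate in \<open>H\<^sup>s\<close>: the difference of \<open>u\<^sub>N\<close> and \<open>\<P>\<^sub>N u\<close> is \<open>O(N\<^sup>-\<^sup>t)\<close> in
  \<open>\<ell>\<^sup>2\<close> and lies in the range of \<open>\<P>\<^sub>N\<close>, where the \<open>H\<^sup>s\<close> norm costs at most a factor \<open>N\<^sup>s\<close>.
\<close>

section \<open>Square-summable sequences and convolution\<close>

text \<open>One predicate for membership in l2 together with a norm bound. Since only finite sets
  are tested, it passes directly to pointwise limits and to dominated sequences.\<close>

definition l2_le :: "lcoef \<Rightarrow> real \<Rightarrow> bool" where
  "l2_le u B \<longleftrightarrow> (\<forall>F. finite F \<longrightarrow> L2_set (\<lambda>j. cmod (u j)) F \<le> B)"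

definition restr :: "int set \<Rightarrow> lcoef \<Rightarrow> lcoef" where
  "restr S u = (\<lambda>j. if j \<in> S then u j else 0)"

abbreviation in_l1 :: "lcoef \<Rightarrow> bool" where
  "in_l1 g \<equiv> (\<lambda>j. cmod (g j)) summable_on UNIV"

definition l1_norm :: "lcoef \<Rightarrow> real" where
  "l1_norm g = (\<Sum>\<^sub>\<infinity>j\<in>UNIV. cmod (g j))"

lemma l2_leD: "l2_le u B \<Longrightarrow> finite F \<Longrightarrow> L2_set (\<lambda>j. cmod (u j)) F \<le> B"
  by (simp add: l2_le_def)

lemma l2_le_nonneg: "l2_le u B \<Longrightarrow> 0 \<le> B"
  using l2_leD[of u B "{}"] by simp

lemma l2_le_bound: "l2_le u B \<Longrightarrow> cmod (u j) \<le> B"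
  using l2_leD[of u B "{j}"] by simp

lemma l2_le_mono: "l2_le u B \<Longrightarrow> B \<le> C \<Longrightarrow> l2_le u C"
  by (force simp: l2_le_def)

lemma l2_le_dominated:
  assumes "l2_le u B" "\<And>j. cmod (v j) \<le> cmod (u j)"
  shows "l2_le v B"
  unfolding l2_le_def
proof (intro allI impI)
  fix F :: "int set" assume "finite F"
  have "L2_set (\<lambda>j. cmod (v j)) F \<le> L2_set (\<lambda>j. cmod (u j)) F"
    by (rule L2_set_mono) (use assms in auto)
  then show "L2_set (\<lambda>j. cmod (v j)) F \<le> B"
    using l2_leD[OF assms(1) \<open>finite F\<close>] by linarith
qed

lemma l2_le_restr: "l2_le u B \<Longrightarrow> l2_le (restr S u) B"
  by (erule l2_le_dominated) (simp add: restr_def)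

lemma l2_le_cmult:
  assumes "l2_le u B" shows "l2_le (\<lambda>j. a * u j) (cmod a * B)"
  unfolding l2_le_def
proof (intro allI impI)
  fix F :: "int set" assume "finite F"
  then show "L2_set (\<lambda>j. cmod (a * u j)) F \<le> cmod a * B"
    using mult_left_mono[OF l2_leD[OF assms \<open>finite F\<close>], of "cmod a"]
    by (simp add: norm_mult L2_set_right_distrib)
qed

lemma l2_le_add:
  assumes "l2_le u B" "l2_le v C" "\<And>j. cmod (w j) \<le> cmod (u j) + cmod (v j)"
  shows "l2_le w (B + C)"
  unfolding l2_le_def
proof (intro allI impI)
  fix F :: "int set" assume "finite F"
  have "L2_set (\<lambda>j. cmod (w j)) F \<le> L2_set (\<lambda>j. cmod (u j) + cmod (v j)) F"
    by (rule L2_set_mono) (use assms in auto)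
  also have "\<dots> \<le> L2_set (\<lambda>j. cmod (u j)) F + L2_set (\<lambda>j. cmod (v j)) F"
    by (rule L2_set_triangle_ineq)
  also have "\<dots> \<le> B + C"
    using assms \<open>finite F\<close> by (intro add_mono l2_leD)
  finally show "L2_set (\<lambda>j. cmod (w j)) F \<le> B + C" .
qed

lemma L2_set_mono_set:
  assumes "finite B" "A \<subseteq> B"
  shows "L2_set f A \<le> L2_set f B"
  unfolding L2_set_def using assms by (intro real_sqrt_le_mono sum_mono2) auto

lemma L2_set_support:
  assumes "finite A" "finite F" "\<And>j. j \<in> F - A \<Longrightarrow> f j = 0"
  shows "L2_set f F \<le> L2_set f A"
proof -
  have "L2_set f F = L2_set f (F \<inter> A)"
    unfolding L2_set_def using assms
    by (intro arg_cong[where f=sqrt] sum.mono_neutral_right) auto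
  also have "\<dots> \<le> L2_set f A"
    using assms by (intro L2_set_mono_set) auto
  finally show ?thesis .
qed

lemma l2_le_finite_support:
  assumes "finite A" "\<And>j. j \<notin> A \<Longrightarrow> u j = 0"
  shows "l2_le u (L2_set (\<lambda>j. cmod (u j)) A)"
  unfolding l2_le_def using assms by (auto intro!: L2_set_support)

lemma l2_le_shift:
  assumes "l2_le u B"
  shows "l2_le (\<lambda>j. u (j - m)) B"
  unfolding l2_le_def
proof (intro allI impI)
  fix F :: "int set" assume F: "finite F"
  have "L2_set (\<lambda>k. cmod (u (k - m))) F = L2_set (\<lambda>k. cmod (u k)) ((\<lambda>k. k - m) ` F)"
    unfolding L2_set_def by (subst sum.reindex) (auto simp: inj_on_def)
  also have "\<dots> \<le> B" using F by (intro l2_leD[OF assms]) auto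
  finally show "L2_set (\<lambda>k. cmod (u (k - m))) F \<le> B" .
qed

lemma l2_le_limit:
  assumes "\<And>n. l2_le (v n) B" "\<And>j. (\<lambda>n. v n j) \<longlonglongrightarrow> x j"
  shows "l2_le x B"
  unfolding l2_le_def
proof (intro allI impI)
  fix F :: "int set" assume F: "finite F"
  have "(\<lambda>n. L2_set (\<lambda>j. cmod (v n j)) F) \<longlonglongrightarrow> L2_set (\<lambda>j. cmod (x j)) F"
    unfolding L2_set_def by (intro tendsto_intros assms)
  then show "L2_set (\<lambda>j. cmod (x j)) F \<le> B"
    by (rule LIMSEQ_le_const2) (use assms F in \<open>auto simp: l2_le_def\<close>)
qed

lemma l2_le_sum_sq:
  assumes "l2_le u B" "finite F"
  shows "(\<Sum>j\<in>F. (cmod (u j))\<^sup>2) \<le> B\<^sup>2"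
  using l2_leD[OF assms] unfolding L2_set_def
  by (metis real_sqrt_le_iff real_sqrt_abs abs_of_nonneg l2_le_nonneg[OF assms(1)])

lemma l2_le_summable:
  assumes "l2_le u B"
  shows "(\<lambda>j. (cmod (u j))\<^sup>2) summable_on UNIV"
  by (rule nonneg_bdd_above_summable_on) (use l2_le_sum_sq[OF assms] in \<open>auto simp: bdd_above_def\<close>)

lemma l2_le_tail:
  assumes "l2_le u B" "e > 0"
  obtains A where "finite A" "l2_le (restr (- A) u) e"
proof -
  let ?f = "\<lambda>j. (cmod (u j))\<^sup>2"
  have sm: "?f summable_on UNIV" by (rule l2_le_summable[OF assms(1)])
  have "eventually (\<lambda>A. dist (sum ?f A) (infsum ?f UNIV) < e\<^sup>2) (finite_subsets_at_top UNIV)"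
    using infsum_tendsto[OF sm] assms(2) by (auto simp: tendsto_iff)
  then obtain A where A: "finite A" "dist (sum ?f A) (infsum ?f UNIV) < e\<^sup>2"
    unfolding eventually_finite_subsets_at_top by blast
  have "l2_le (restr (- A) u) e"
    unfolding l2_le_def
  proof (intro allI impI)
    fix F :: "int set" assume F: "finite F"
    have "(\<Sum>j\<in>F. (cmod (restr (- A) u j))\<^sup>2) = sum ?f (F - A)"
      using F by (intro sum.mono_neutral_cong_right) (auto simp: restr_def)
    also have "\<dots> = sum ?f (F \<union> A) - sum ?f A"
      using sum.subset_diff[of A "F \<union> A" ?f] F A by (simp add: Un_Diff)
    also have "sum ?f (F \<union> A) \<le> infsum ?f UNIV"
      using F A by (intro finite_sum_le_infsum sm) auto
    also have "infsum ?f UNIV - sum ?f A \<le> e\<^sup>2"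
      using A(2) by (simp add: dist_real_def)
    finally show "L2_set (\<lambda>j. cmod (restr (- A) u j)) F \<le> e"
      unfolding L2_set_def using assms(2) by (simp add: real_le_lsqrt sum_nonneg)
  qed
  with A(1) show ?thesis using that by blast
qed

section \<open>Convolution by absolutely summable sequences\<close>

lemma l1_norm_nonneg: "0 \<le> l1_norm g"
  by (simp add: l1_norm_def infsum_nonneg)

lemma in_l1_restr:
  "in_l1 g \<Longrightarrow> in_l1 (restr S g)"
  by (rule Infinite_Sum.abs_summable_on_comparison_test[of g]) (auto simp: restr_def)

lemma l1_tail:
  assumes "in_l1 g" "e > 0"
  obtains A where "finite A" "\<And>S. S \<inter> A = {} \<Longrightarrow> l1_norm (restr S g) \<le> e"
proof -
  let ?f = "\<lambda>j. cmod (g j)"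
  have "eventually (\<lambda>A. dist (sum ?f A) (infsum ?f UNIV) < e) (finite_subsets_at_top UNIV)"
    using infsum_tendsto[OF assms(1)] assms(2) by (auto simp: tendsto_iff)
  then obtain A where A: "finite A" "dist (sum ?f A) (infsum ?f UNIV) < e"
    unfolding eventually_finite_subsets_at_top by blast
  have "l1_norm (restr S g) \<le> e" if "S \<inter> A = {}" for S
    unfolding l1_norm_def
  proof (rule infsum_le_finite_sums)
    show "(\<lambda>j. cmod (restr S g j)) summable_on UNIV"
      by (rule in_l1_restr[OF assms(1)])
    fix F :: "int set" assume F: "finite F"
    have "(\<Sum>j\<in>F. cmod (restr S g j)) \<le> sum ?f (F - A)"
    proof -
      have "(\<Sum>j\<in>F. cmod (restr S g j)) = (\<Sum>j\<in>F-A. cmod (restr S g j))"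
        using F that by (intro sum.mono_neutral_right) (auto simp: restr_def)
      also have "\<dots> \<le> sum ?f (F - A)"
        by (intro sum_mono) (auto simp: restr_def)
      finally show ?thesis .
    qed
    also have "\<dots> = sum ?f (F \<union> A) - sum ?f A"
      using sum.subset_diff[of A "F \<union> A" ?f] F A by (simp add: Un_Diff)
    also have "sum ?f (F \<union> A) \<le> infsum ?f UNIV"
      using F A by (intro finite_sum_le_infsum assms) auto
    also have "infsum ?f UNIV - sum ?f A \<le> e"
      using A(2) by (simp add: dist_real_def)
    finally show "(\<Sum>j\<in>F. cmod (restr S g j)) \<le> e" by simp
  qed
  with A(1) show ?thesis using that by blast
qed

lemma Mult_abs_summable:
  assumes "in_l1 g" "\<And>j. cmod (u j) \<le> B"
  shows "(\<lambda>j. cmod (g j * u (k - j))) summable_on UNIV"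
proof (rule Infinite_Sum.abs_summable_on_comparison_test')
  show "(\<lambda>j. cmod (g j) * B) summable_on UNIV"
    by (rule summable_on_cmult_left[OF assms(1)])
  show "cmod (g j * u (k - j)) \<le> cmod (g j) * B" for j
    unfolding norm_mult by (intro mult_left_mono assms) auto
qed

lemma Mult_summable:
  assumes "in_l1 g" "\<And>j. cmod (u j) \<le> B"
  shows "(\<lambda>j. g j * u (k - j)) summable_on UNIV"
  using Mult_abs_summable[OF assms] by (rule abs_summable_summable)

lemma Mult_le:
  assumes "in_l1 g" "\<And>j. cmod (u j) \<le> B"
  shows "cmod (Mult g u k) \<le> l1_norm g * B"
proof -
  have "cmod (Mult g u k) \<le> (\<Sum>\<^sub>\<infinity>j. cmod (g j * u (k - j)))"
    unfolding Mult_def by (rule norm_infsum_bound) (rule Mult_abs_summable[OF assms])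
  also have "\<dots> \<le> (\<Sum>\<^sub>\<infinity>j. cmod (g j) * B)"
    by (intro infsum_mono summable_on_cmult_left Mult_abs_summable[OF assms] assms(1))
       (auto simp: norm_mult intro!: mult_left_mono assms)
  also have "\<dots> = l1_norm g * B"
    unfolding l1_norm_def by (rule infsum_cmult_left) (use assms in auto)
  finally show ?thesis .
qed

lemma Mult_add_right:
  assumes "in_l1 g" "\<And>j. cmod (u j) \<le> B" "\<And>j. cmod (v j) \<le> C"
  shows "Mult g (\<lambda>j. u j + v j) k = Mult g u k + Mult g v k"
  unfolding Mult_def
  by (subst infsum_add[symmetric])
     (auto simp: distrib_left intro!: Mult_summable assms)

lemma Mult_cmult_right: "Mult g (\<lambda>j. a * u j) k = a * Mult g u k"
proof -
  have "(\<Sum>\<^sub>\<infinity>j. g j * (a * u (k - j))) = (\<Sum>\<^sub>\<infinity>j. a * (g j * u (k - j)))"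
    by (intro infsum_cong) (simp add: algebra_simps)
  then show ?thesis
    unfolding Mult_def by (simp add: infsum_cmult_right')
qed

lemma Mult_add_left:
  assumes "in_l1 g" "in_l1 h" "\<And>j. cmod (u j) \<le> B"
  shows "Mult (\<lambda>j. g j + h j) u k = Mult g u k + Mult h u k"
  unfolding Mult_def
  by (subst infsum_add[symmetric])
     (auto simp: distrib_right intro!: Mult_summable assms)

lemma restr_split: "(\<lambda>j. restr A g j + restr (- A) g j) = g"
  by (auto simp: restr_def fun_eq_iff)

lemma Mult_split_left:
  assumes "in_l1 g" "\<And>j. cmod (u j) \<le> B"
  shows "Mult g u k = Mult (restr A g) u k + Mult (restr (- A) g) u k"
  using Mult_add_left[OF in_l1_restr[OF assms(1), of A] in_l1_restr[OF assms(1), of "- A"] assms(2), where k=k]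
  unfolding restr_split .

lemma Mult_commute: "Mult g u = Mult u g"
proof
  show "Mult g u k = Mult u g k" for k
    unfolding Mult_def
    by (rule infsum_reindex_bij_witness[where i="\<lambda>j. k - j" and j="\<lambda>j. k - j"])
       (auto simp: algebra_simps)
qed

lemma Mult_shift: "Mult g (\<lambda>j. u (j - m)) k = Mult g u (k - m)"
  unfolding Mult_def by (simp add: algebra_simps)

text \<open>The family \<open>a i * b j\<close> is absolutely summable over pairs and
  \<open>u\<close> is bounded, so the two sums may be interchanged after the shear of
  \<open>(i, j)\<close> to \<open>(i, j - i)\<close>.\<close>

lemma Mult_assoc:
  assumes a: "in_l1 a" and b: "in_l1 b"
    and u: "\<And>j. cmod (u j) \<le> B"
  shows "Mult a (Mult b u) = Mult (Mult a b) u"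
proof
  fix k
  let ?f = "\<lambda>i j. a i * (b j * u (k - i - j))"
  let ?h = "\<lambda>i j. a i * (b (j - i) * u (k - j))"
  have B0: "B \<ge> 0" using u[of 0] norm_ge_zero order_trans by blast
  have "(\<lambda>x. cmod (case x of (i,j) \<Rightarrow> a i * b j)) summable_on UNIV \<times> UNIV"
    by (subst Infinite_Sum.abs_summable_on_Sigma_iff)
       (auto simp: norm_mult infsum_cmult_right' abs_mult infsum_nonneg intro!: summable_on_cmult_right summable_on_cmult_left a b)
  then have "(\<lambda>x. cmod (case x of (i,j) \<Rightarrow> a i * b j) * B) summable_on UNIV \<times> UNIV"
    by (rule summable_on_cmult_left)
  then have "(\<lambda>x. cmod (case x of (i,j) \<Rightarrow> ?f i j)) summable_on UNIV \<times> UNIV"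
    by (rule Infinite_Sum.abs_summable_on_comparison_test')
       (auto simp: norm_mult mult.assoc intro!: mult_left_mono u)
  then have sf: "(\<lambda>(i,j). ?f i j) summable_on UNIV \<times> UNIV"
    by (rule abs_summable_summable)
  have bij: "bij_betw (\<lambda>(i,j). (i, j - i)) (UNIV \<times> UNIV) (UNIV \<times> (UNIV :: int set))"
    by (rule bij_betwI[where g="\<lambda>(i,j). (i, j + i)"]) auto
  have sh: "(\<lambda>(i,j). ?h i j) summable_on UNIV \<times> UNIV"
    using sf summable_on_reindex_bij_betw[OF bij, of "\<lambda>(i,j). ?f i j"]
    by (simp add: case_prod_unfold algebra_simps)
  have fh: "(\<Sum>\<^sub>\<infinity>j. ?f i j) = (\<Sum>\<^sub>\<infinity>j. ?h i j)" for i
    by (rule infsum_reindex_bij_witness[where i="\<lambda>j. j - i" and j="\<lambda>j. j + i"])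
       (auto simp: algebra_simps)
  have "Mult a (Mult b u) k = (\<Sum>\<^sub>\<infinity>i. \<Sum>\<^sub>\<infinity>j. ?h i j)"
    unfolding Mult_def fh[symmetric] by (simp add: infsum_cmult_right')
  also have "\<dots> = (\<Sum>\<^sub>\<infinity>j. \<Sum>\<^sub>\<infinity>i. ?h i j)"
    by (rule infsum_swap_banach[OF sh])
  also have "\<dots> = Mult (Mult a b) u k"
    unfolding Mult_def by (simp add: infsum_cmult_left' mult.assoc[symmetric])
  finally show "Mult a (Mult b u) k = Mult (Mult a b) u k" .
qed

text \<open>Young's inequality. Convolution by \<open>g\<close> is a superposition of shifts, which
  preserve the l2 bound; Minkowski's inequality settles finitely many shifts, and the limit over
  finite sets \<open>J\<close> gives the rest.\<close>

lemma l2_le_Mult: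
  assumes g: "in_l1 g" and u: "l2_le u B"
  shows "l2_le (Mult g u) (l1_norm g * B)"
  unfolding l2_le_def
proof (intro allI impI)
  fix F :: "int set" assume F: "finite F"
  have shift: "L2_set (\<lambda>k. cmod (u (k - j))) F \<le> B" for j
    by (rule l2_leD[OF l2_le_shift[OF u] F])
  have part: "L2_set (\<lambda>k. cmod (\<Sum>j\<in>J. g j * u (k - j))) F \<le> (\<Sum>j\<in>J. cmod (g j)) * B"
    if "finite J" for J
    using that
  proof (induction J rule: finite_induct)
    case empty
    then show ?case by (simp add: L2_set_0')
  next
    case (insert i J)
    have "L2_set (\<lambda>k. cmod (\<Sum>j\<in>insert i J. g j * u (k - j))) F
       \<le> L2_set (\<lambda>k. cmod (g i) * cmod (u (k - i)) + cmod (\<Sum>j\<in>J. g j * u (k - j))) F"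
      using insert by (intro L2_set_mono) (auto intro!: norm_triangle_mono simp: norm_mult)
    also have "\<dots> \<le> L2_set (\<lambda>k. cmod (g i) * cmod (u (k - i))) F
        + L2_set (\<lambda>k. cmod (\<Sum>j\<in>J. g j * u (k - j))) F"
      by (rule L2_set_triangle_ineq)
    also have "\<dots> \<le> cmod (g i) * B + (\<Sum>j\<in>J. cmod (g j)) * B"
      unfolding L2_set_right_distrib[OF norm_ge_zero, symmetric]
      by (intro add_mono insert mult_left_mono shift) auto
    finally show ?case using insert by (simp add: distrib_right)
  qed
  have lim: "((\<lambda>J. \<Sum>j\<in>J. g j * u (k - j)) \<longlongrightarrow> Mult g u k) (finite_subsets_at_top UNIV)" for k
    unfolding Mult_def by (intro infsum_tendsto Mult_summable[OF g, where B=B] l2_le_bound[OF u])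
  have "((\<lambda>J. L2_set (\<lambda>k. cmod (\<Sum>j\<in>J. g j * u (k - j))) F) \<longlongrightarrow> L2_set (\<lambda>k. cmod (Mult g u k)) F)
      (finite_subsets_at_top UNIV)"
    unfolding L2_set_def by (intro tendsto_intros lim)
  then show "L2_set (\<lambda>k. cmod (Mult g u k)) F \<le> l1_norm g * B"
  proof (rule tendsto_upperbound)
    show "\<forall>\<^sub>F J in finite_subsets_at_top UNIV.
        L2_set (\<lambda>k. cmod (\<Sum>j\<in>J. g j * u (k - j))) F \<le> l1_norm g * B"
    proof (rule eventually_finite_subsets_at_top_weakI)
      fix J :: "int set" assume J: "finite J"
      have "(\<Sum>j\<in>J. cmod (g j)) \<le> l1_norm g"
        unfolding l1_norm_def using J by (intro finite_sum_le_infsum g) auto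
      then show "L2_set (\<lambda>k. cmod (\<Sum>j\<in>J. g j * u (k - j))) F \<le> l1_norm g * B"
        using part[OF J] mult_right_mono[OF _ l2_le_nonneg[OF u]] by (meson order_trans)
    qed
  qed simp
qed

text \<open>Dominated convergence: finitely many coefficients of \<open>g\<close> are handled
  termwise, the others have small l1 norm against the uniform bound \<open>B\<close>.\<close>

lemma Mult_tendsto:
  assumes g: "in_l1 g" and v: "\<And>n j. cmod (v n j) \<le> B"
    and lim: "\<And>j. (\<lambda>n. v n j) \<longlonglongrightarrow> x j"
  shows "(\<lambda>n. Mult g (v n) k) \<longlonglongrightarrow> Mult g x k"
proof -
  have B0: "B \<ge> 0" using v[of 0 0] norm_ge_zero order_trans by blast
  have x: "cmod (x j) \<le> B" for j
    using tendsto_norm[OF lim[of j]] by (rule LIMSEQ_le_const2) (use v in auto)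
  show ?thesis
  proof (rule LIMSEQ_I)
    fix r :: real assume r: "r > 0"
    \<comment> \<open>Each of the two tails is then at most \<open>r / 4\<close>, which leaves
      \<open>r / 2\<close> for the finite part. Using \<open>B + 1\<close> avoids division by
      zero.\<close>
    define e where "e = r / (4 * (B + 1))"
    have e: "e > 0" unfolding e_def using r B0 by auto
    obtain A where A: "finite A" "\<And>S. S \<inter> A = {} \<Longrightarrow> l1_norm (restr S g) \<le> e"
      using l1_tail[OF g e] by blast
    have split: "Mult g w k = (\<Sum>j\<in>A. g j * w (k - j)) + Mult (restr (-A) g) w k"
      if w: "\<And>j. cmod (w j) \<le> B" for w
    proof -
      have "Mult g w k = Mult (restr A g) w k + Mult (restr (-A) g) w k"
        by (rule Mult_split_left[OF g w])
      also have "Mult (restr A g) w k = (\<Sum>\<^sub>\<infinity>j\<in>A. g j * w (k - j))"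
        unfolding Mult_def by (rule infsum_cong_neutral) (auto simp: restr_def)
      finally show ?thesis using A(1) by simp
    qed
    have tail: "cmod (Mult (restr (-A) g) w k) \<le> e * B" if w: "\<And>j. cmod (w j) \<le> B" for w
    proof -
      have "cmod (Mult (restr (-A) g) w k) \<le> l1_norm (restr (-A) g) * B"
        by (intro Mult_le in_l1_restr g w)
      also have "\<dots> \<le> e * B" using B0 by (intro mult_right_mono A) auto
      finally show ?thesis .
    qed
    have "(\<lambda>n. \<Sum>j\<in>A. g j * v n (k - j)) \<longlonglongrightarrow> (\<Sum>j\<in>A. g j * x (k - j))"
      by (intro tendsto_intros lim)
    then obtain n0 where n0: "\<And>n. n \<ge> n0 \<Longrightarrow>
        cmod ((\<Sum>j\<in>A. g j * v n (k - j)) - (\<Sum>j\<in>A. g j * x (k - j))) < r / 2"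
      using r LIMSEQ_D[of _ _ "r/2"] by (meson half_gt_zero)
    have "e * B \<le> e * (B + 1)" using e by (intro mult_left_mono) auto
    also have "\<dots> = r / 4" unfolding e_def using B0 by (simp add: field_simps)
    finally have eB: "e * B \<le> r / 4" .
    have "cmod (Mult g (v n) k - Mult g x k) < r" if "n \<ge> n0" for n
    proof -
      let ?a = "(\<Sum>j\<in>A. g j * v n (k - j)) - (\<Sum>j\<in>A. g j * x (k - j))"
      let ?b = "Mult (restr (-A) g) (v n) k" and ?c = "Mult (restr (-A) g) x k"
      have "Mult g (v n) k - Mult g x k = ?a + (?b - ?c)"
        using split[of "v n"] split[of x] v x by (simp add: algebra_simps)
      then have "cmod (Mult g (v n) k - Mult g x k) \<le> cmod ?a + (cmod ?b + cmod ?c)"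
        using norm_triangle_ineq[of ?a "?b - ?c"] norm_triangle_ineq4[of ?b ?c] by simp
      then show ?thesis
        using n0[OF that] tail[of "v n", OF v] tail[of x, OF x] eB by linarith
    qed
    then show "\<exists>n0. \<forall>n\<ge>n0. cmod (Mult g (v n) k - Mult g x k) < r" by blast
  qed
qed

section \<open>Multiplication is bounded below\<close>

lemma sum_roots_of_unity:
  assumes "d \<noteq> 0" "\<bar>d\<bar> < int n"
  shows "(\<Sum>m<n. cis (2 * pi * real m / real n) powi d) = 0"
proof -
  define w where "w = cis (2 * pi * real_of_int d / real n)"
  have n: "n > 0" using assms by auto
  have "(\<Sum>m<n. cis (2 * pi * real m / real n) powi d) = (\<Sum>m<n. w ^ m)"
  proof (intro sum.cong refl)
    fix m
    show "cis (2 * pi * real m / real n) powi d = w ^ m"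
      unfolding w_def cis_power_int Complex.DeMoivre by (rule arg_cong[where f=cis]) simp
  qed
  moreover have "w ^ n = 1"
  proof -
    have "w ^ n = cis (2 * pi * real_of_int d)"
      unfolding w_def Complex.DeMoivre using n by simp
    also have "\<dots> = 1" by (rule cis_multiple_2pi) auto
    finally show ?thesis .
  qed
  moreover have "w \<noteq> 1"
  proof
    assume "w = 1"
    then have "cos (2 * pi * real_of_int d / real n) = 1"
      unfolding w_def by (simp add: complex_eq_iff)
    then obtain k :: int where "2 * pi * real_of_int d / real n = real_of_int k * 2 * pi"
      unfolding cos_one_2pi_int by auto
    then have "real_of_int d = real_of_int (k * int n)" using n by (simp add: field_simps)
    then have "d = k * int n" by linarith
    then show False
      using assms zdvd_imp_le[of "int n" "\<bar>d\<bar>"] by auto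
  qed
  ultimately show ?thesis by (simp add: geometric_sum)
qed

lemma discrete_parseval:
  fixes a :: lcoef
  assumes "\<And>i j. i \<in> S \<Longrightarrow> j \<in> S \<Longrightarrow> \<bar>i - j\<bar> < int n"
  shows "(\<Sum>m<n. (cmod (\<Sum>j\<in>S. a j * cis (2 * pi * real m / real n) powi j))\<^sup>2) =
           real n * (\<Sum>j\<in>S. (cmod (a j))\<^sup>2)"
proof (cases "finite S")
  case True
  define z where "z m = cis (2 * pi * real m / real n)" for m
  have zz: "z m powi i * cnj (z m powi j) = z m powi (i - j)" for m i j
    unfolding z_def cis_power_int by (simp add: cis_cnj cis_mult algebra_simps diff_divide_distrib)
  have "complex_of_real (\<Sum>m<n. (cmod (\<Sum>j\<in>S. a j * z m powi j))\<^sup>2) =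
      (\<Sum>m<n. \<Sum>i\<in>S. \<Sum>j\<in>S. a i * cnj (a j) * z m powi (i - j))"
    unfolding of_real_sum complex_norm_square cnj_sum sum_product zz[symmetric]
    by (simp add: algebra_simps)
  also have "\<dots> = (\<Sum>i\<in>S. \<Sum>j\<in>S. a i * cnj (a j) * (\<Sum>m<n. z m powi (i - j)))"
    by (subst sum.swap, intro sum.cong refl, subst sum.swap) (simp add: sum_distrib_left)
  also have "\<dots> = (\<Sum>i\<in>S. \<Sum>j\<in>S. if j = i then a i * cnj (a i) * of_nat n else 0)"
    using assms by (intro sum.cong refl) (auto simp: z_def sum_roots_of_unity)
  also have "\<dots> = complex_of_real (real n * (\<Sum>j\<in>S. (cmod (a j))\<^sup>2))"
    using True by (simp add: complex_norm_square sum_distrib_left mult.commute del: of_real_power)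
  finally show ?thesis unfolding z_def of_real_eq_iff .
qed simp

lemma Mult_finite_support:
  assumes "finite A" "\<And>j. j \<notin> A \<Longrightarrow> g j = 0"
  shows "Mult g x k = (\<Sum>j\<in>A. g j * x (k - j))"
proof -
  have "Mult g x k = (\<Sum>\<^sub>\<infinity>j\<in>A. g j * x (k - j))"
    unfolding Mult_def by (rule infsum_cong_neutral) (use assms in auto)
  then show ?thesis using assms by simp
qed

lemma sum_shift_support:
  fixes f :: "int \<Rightarrow> complex"
  assumes "\<And>i. i \<notin> {-K..K} \<Longrightarrow> f i = 0" "j \<in> {-K..K}"
  shows "(\<Sum>k\<in>{-2*K..2*K}. f (k - j)) = (\<Sum>i\<in>{-K..K}. f i)"
proof (rule sum.reindex_bij_witness_not_neutral[where i="\<lambda>i. i + j" and j="\<lambda>k. k - j"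
        and S'="{k \<in> {-2*K..2*K}. k - j \<notin> {-K..K}}" and T'="{}"])
  show "finite {k \<in> {-2*K..2*K}. k - j \<notin> {-K..K}}"
    by (rule finite_subset[of _ "{-2*K..2*K}"]) auto
qed (use assms in auto)

lemma lpoly_Mult:
  assumes g: "\<And>j. j \<notin> {-K..K} \<Longrightarrow> g j = 0" and x: "\<And>j. j \<notin> {-K..K} \<Longrightarrow> x j = 0"
    and z: "z \<noteq> 0"
  shows "(\<Sum>k\<in>{-2*K..2*K}. Mult g x k * z powi k) =
         (\<Sum>j\<in>{-K..K}. g j * z powi j) * (\<Sum>j\<in>{-K..K}. x j * z powi j)"
proof -
  have "(\<Sum>k\<in>{-2*K..2*K}. Mult g x k * z powi k)
      = (\<Sum>k\<in>{-2*K..2*K}. \<Sum>j\<in>{-K..K}. g j * x (k - j) * z powi k)"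
    by (subst Mult_finite_support[of "{-K..K}"]) (use g in \<open>auto simp: sum_distrib_right\<close>)
  also have "\<dots> = (\<Sum>j\<in>{-K..K}. \<Sum>k\<in>{-2*K..2*K}. g j * x (k - j) * z powi k)"
    by (rule sum.swap)
  also have "\<dots> = (\<Sum>j\<in>{-K..K}. g j * z powi j * (\<Sum>i\<in>{-K..K}. x i * z powi i))"
  proof (intro sum.cong refl)
    fix j assume j: "j \<in> {-K..K}"
    have zk: "z powi k = z powi j * z powi (k - j)" for k
      using z power_int_add[of z j "k - j"] by simp
    have "(\<Sum>k\<in>{-2*K..2*K}. g j * x (k - j) * z powi k)
        = g j * z powi j * (\<Sum>k\<in>{-2*K..2*K}. x (k - j) * z powi (k - j))"
      unfolding sum_distrib_left by (intro sum.cong refl) (subst zk, simp add: mult_ac)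
    also have "(\<Sum>k\<in>{-2*K..2*K}. x (k - j) * z powi (k - j)) = (\<Sum>i\<in>{-K..K}. x i * z powi i)"
      by (rule sum_shift_support[OF _ j, of "\<lambda>i. x i * z powi i"]) (use x in auto)
    finally show "(\<Sum>k\<in>{-2*K..2*K}. g j * x (k - j) * z powi k)
        = g j * z powi j * (\<Sum>i\<in>{-K..K}. x i * z powi i)" .
  qed
  finally show ?thesis by (simp add: sum_distrib_right)
qed

text \<open>At every node the value of the convolution is the product of the two values, and the
  first factor has modulus at least \<open>d\<close>. Parseval transfers this to the
  coefficients.\<close>

lemma Mult_lower_bound_lpoly:
  assumes g: "\<And>j. j \<notin> {-K..K} \<Longrightarrow> g j = 0" and x: "\<And>j. j \<notin> {-K..K} \<Longrightarrow> x j = 0"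
    and d: "d \<ge> 0" "\<And>z. cmod z = 1 \<Longrightarrow> cmod (\<Sum>j\<in>{-K..K}. g j * z powi j) \<ge> d"
    and K: "K \<ge> 0"
  shows "d * L2_set (\<lambda>j. cmod (x j)) {-K..K} \<le> L2_set (\<lambda>j. cmod (Mult g x j)) {-2*K..2*K}"
proof -
  \<comment> \<open>The product has frequencies in \<open>{-2*K..2*K}\<close>, whose differences
    reach \<open>4 * K\<close>; one node more excludes aliasing.\<close>
  define n where "n = nat (4 * K + 1)"
  define z where "z m = cis (2 * pi * real m / real n)" for m
  have n: "n > 0" "int n = 4 * K + 1" using K by (auto simp: n_def)
  have "real n * (d\<^sup>2 * (\<Sum>j\<in>{-K..K}. (cmod (x j))\<^sup>2)) =
      (\<Sum>m<n. d\<^sup>2 * (cmod (\<Sum>j\<in>{-K..K}. x j * z m powi j))\<^sup>2)"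
    unfolding sum_distrib_left[symmetric] z_def
    by (subst discrete_parseval) (use n K in auto)
  also have "\<dots> \<le> (\<Sum>m<n. (cmod (\<Sum>k\<in>{-2*K..2*K}. Mult g x k * z m powi k))\<^sup>2)"
  proof (intro sum_mono)
    fix m
    have z0: "z m \<noteq> 0" "cmod (z m) = 1" by (auto simp: z_def)
    have "d * cmod (\<Sum>j\<in>{-K..K}. x j * z m powi j) \<le>
        cmod (\<Sum>k\<in>{-2*K..2*K}. Mult g x k * z m powi k)"
      by (subst lpoly_Mult[OF g x z0(1)])
         (auto simp: norm_mult intro!: mult_right_mono d z0)
    then show "d\<^sup>2 * (cmod (\<Sum>j\<in>{-K..K}. x j * z m powi j))\<^sup>2 \<le>
        (cmod (\<Sum>k\<in>{-2*K..2*K}. Mult g x k * z m powi k))\<^sup>2"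
      unfolding power_mult_distrib[symmetric] using d by (intro power_mono) auto
  qed
  also have "\<dots> = real n * (\<Sum>k\<in>{-2*K..2*K}. (cmod (Mult g x k))\<^sup>2)"
    unfolding z_def by (rule discrete_parseval) (use n in auto)
  finally have "d\<^sup>2 * (\<Sum>j\<in>{-K..K}. (cmod (x j))\<^sup>2) \<le> (\<Sum>k\<in>{-2*K..2*K}. (cmod (Mult g x k))\<^sup>2)"
    using n by simp
  then have "sqrt (d\<^sup>2 * (\<Sum>j\<in>{-K..K}. (cmod (x j))\<^sup>2)) \<le> sqrt (\<Sum>k\<in>{-2*K..2*K}. (cmod (Mult g x k))\<^sup>2)"
    by (rule real_sqrt_le_mono)
  then show ?thesis using d by (simp add: L2_set_def real_sqrt_mult)
qed

text \<open>For \<open>z\<close> on the circle the sequence of \<open>z powi (- j)\<close> is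
  bounded, so the l1 estimates for \<open>Mult\<close> also control point values of the
  symbol.\<close>

lemma lval_eq_Mult: "lval g z = Mult g (\<lambda>j. z powi (- j)) 0"
  by (simp add: lval_def Mult_def)

text \<open>Cutting the symbol to \<open>{-K..K}\<close> lowers its minimum modulus by at most
  \<open>e\<close> and changes the product with \<open>x\<close> by at most \<open>e * X\<close> in
  l2; the Laurent polynomial case then applies.\<close>

lemma Mult_lower_bound:
  assumes g: "in_l1 g" and d: "d > 0" "\<And>z. cmod z = 1 \<Longrightarrow> cmod (lval g z) \<ge> d"
    and A: "finite A" "\<And>j. j \<notin> A \<Longrightarrow> x j = 0" and B: "l2_le (Mult g x) B"
  shows "d * L2_set (\<lambda>j. cmod (x j)) A \<le> B"
proof (rule ccontr)
  define X where "X = L2_set (\<lambda>j. cmod (x j)) A"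
  assume "\<not> ?thesis"
  then have less: "d * X > B" by (simp add: X_def)
  have B0: "B \<ge> 0" using l2_le_nonneg[OF B] .
  have X: "X > 0" using less B0 d(1) zero_less_mult_pos[of d X] by linarith
  \<comment> \<open>Then \<open>4 * e * X = d * X - B\<close>, whereas the estimates below end in
    \<open>(d - e) * X \<le> B + e * X\<close>, that is
    \<open>d * X - B \<le> 2 * e * X\<close>.\<close>
  define e where "e = (d * X - B) / (4 * X)"
  have e: "e > 0" unfolding e_def using less X by simp
  have eX: "4 * e * X = d * X - B" unfolding e_def using X by simp
  have "e * X \<le> d * X" using eX B0 mult_pos_pos[OF e X] by linarith
  then have ed: "e \<le> d" using X by simp
  have xX: "l2_le x X" unfolding X_def by (rule l2_le_finite_support[OF A])
  obtain A0 where A0: "finite A0" "\<And>S. S \<inter> A0 = {} \<Longrightarrow> l1_norm (restr S g) \<le> e"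
    using l1_tail[OF g e] by blast
  define K where "K = Max (insert 0 (abs ` (A \<union> A0)))"
  have K: "K \<ge> 0" unfolding K_def using A A0 by (intro Max_ge) auto
  have "\<bar>j\<bar> \<le> K" if "j \<in> A \<union> A0" for j
    unfolding K_def using A A0 that by (intro Max_ge) auto
  then have sub: "A \<subseteq> {-K..K}" "A0 \<subseteq> {-K..K}" by fastforce+
  define h where "h = restr {-K..K} g"
  define r where "r = restr (- {-K..K}) g"
  have r: "in_l1 r" "l1_norm r \<le> e"
    unfolding r_def using sub by (auto intro!: in_l1_restr g A0(2))
  have split: "Mult g u k = Mult h u k + Mult r u k" if "\<And>j. cmod (u j) \<le> C" for u C k
    unfolding h_def r_def by (rule Mult_split_left[OF g that])
  have 1: "(d - e) * L2_set (\<lambda>j. cmod (x j)) {-K..K} \<le> L2_set (\<lambda>j. cmod (Mult h x j)) {-2*K..2*K}"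
  proof (rule Mult_lower_bound_lpoly[OF _ _ _ _ K])
    show "h j = 0" if "j \<notin> {-K..K}" for j using that unfolding h_def restr_def by (simp only: if_False)
    show "x j = 0" if "j \<notin> {-K..K}" for j using that sub A(2)[of j] by blast
    show "0 \<le> d - e" using ed by simp
    fix z :: complex assume z: "cmod z = 1"
    let ?u = "\<lambda>j. z powi (- j)"
    have u: "cmod (?u j) \<le> 1" for j using z by (simp add: norm_power_int)
    have "lval g z = Mult h ?u 0 + Mult r ?u 0"
      unfolding lval_eq_Mult by (rule split[of ?u 1, OF u])
    moreover have "cmod (Mult r ?u 0) \<le> e"
      using Mult_le[of r ?u 1 0, OF r(1) u] r(2) by simp
    moreover have "Mult h ?u 0 = (\<Sum>j\<in>{-K..K}. h j * z powi j)"
      by (subst Mult_finite_support[of "{-K..K}"]) (auto simp: h_def restr_def)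
    ultimately show "d - e \<le> cmod (\<Sum>j\<in>{-K..K}. h j * z powi j)"
      using d(2)[OF z] norm_triangle_ineq[of "Mult h ?u 0" "Mult r ?u 0"] by simp
  qed
  have 2: "X \<le> L2_set (\<lambda>j. cmod (x j)) {-K..K}"
    unfolding X_def by (rule L2_set_mono_set) (use sub in auto)
  have "l2_le (Mult h x) (B + e * X)"
  proof (rule l2_le_add[OF B])
    show "l2_le (Mult r x) (e * X)"
      by (rule l2_le_mono[OF l2_le_Mult[OF r(1) xX]]) (use r X in auto)
    have "Mult h x j = Mult g x j - Mult r x j" for j
      using split[of x X j, OF l2_le_bound[OF xX]] by simp
    then show "cmod (Mult h x j) \<le> cmod (Mult g x j) + cmod (Mult r x j)" for j
      by (simp add: norm_triangle_ineq4)
  qed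
  then have 3: "L2_set (\<lambda>j. cmod (Mult h x j)) {-2*K..2*K} \<le> B + e * X"
    by (rule l2_leD) auto
  have "(d - e) * X \<le> B + e * X"
    using 1 3 mult_left_mono[OF 2, of "d - e"] ed by linarith
  then show False using eX mult_pos_pos[OF e X] by (simp add: algebra_simps)
qed

text \<open>The lower bound is applied to a truncation of \<open>y\<close>. As
  \<open>g y = 0\<close>, the image of the truncation is minus the image of the tail, hence
  small.\<close>

lemma Mult_injective:
  assumes g: "in_l1 g" and d: "d > 0" "\<And>z. cmod z = 1 \<Longrightarrow> cmod (lval g z) \<ge> d"
    and y: "l2_le y B" and 0: "\<And>k. Mult g y k = 0"
  shows "y i = 0"
proof (rule ccontr)
  assume "y i \<noteq> 0"
  define D where "D = l1_norm g + d"
  \<comment> \<open>The argument yields \<open>d * cmod (y i) \<le> D * e\<close>, whose right-hand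
    side is half of the left for this \<open>e\<close>. The summand \<open>d\<close> in
    \<open>D\<close> pays for a possible entry \<open>i\<close> of the tail.\<close>
  define e where "e = d * cmod (y i) / (2 * D)"
  have G: "D > 0" unfolding D_def using l1_norm_nonneg[of g] d(1) by linarith
  have e: "e > 0" unfolding e_def using d(1) G \<open>y i \<noteq> 0\<close> by simp
  obtain A where A: "finite A" "l2_le (restr (- A) y) e"
    using l2_le_tail[OF y e] by blast
  have "l2_le (Mult g (restr A y)) (l1_norm g * e)"
  proof (rule l2_le_dominated[OF l2_le_Mult[OF g A(2)]])
    fix k
    have "Mult g y k = Mult g (restr A y) k + Mult g (restr (- A) y) k"
      using Mult_add_right[of g "restr A y" B "restr (- A) y" e k, OF g
          l2_le_bound[OF l2_le_restr[OF y]] l2_le_bound[OF A(2)]]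
      unfolding restr_split .
    then show "cmod (Mult g (restr A y) k) \<le> cmod (Mult g (restr (- A) y) k)"
      using 0 by (simp add: add_eq_0_iff)
  qed
  then have 3: "d * L2_set (\<lambda>j. cmod (restr A y j)) A \<le> l1_norm g * e"
    by (intro Mult_lower_bound[OF g d A(1)]) (auto simp: restr_def)
  have "l2_le (restr A y) (L2_set (\<lambda>j. cmod (restr A y j)) A)"
    by (rule l2_le_finite_support[OF A(1)]) (simp add: restr_def)
  then have 4: "cmod (restr A y i) \<le> L2_set (\<lambda>j. cmod (restr A y j)) A"
    by (rule l2_le_bound)
  have 1: "d * cmod (restr A y i) \<le> l1_norm g * e"
    using 3 mult_left_mono[OF 4, of d] d(1) by linarith
  have 2: "cmod (restr (- A) y i) \<le> e"
    by (rule l2_le_bound[OF A(2)])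
  have "cmod (y i) = cmod (restr A y i) + cmod (restr (- A) y i)"
    by (simp add: restr_def)
  then have "d * cmod (y i) \<le> D * e"
    unfolding D_def using 1 mult_left_mono[OF 2, of d] d(1) by (simp only: distrib_left distrib_right) linarith
  also have "\<dots> = d * cmod (y i) / 2" unfolding e_def using G by simp
  finally show False using d(1) \<open>y i \<noteq> 0\<close> by simp
qed

section \<open>Stability of finite sections\<close>

text \<open>Meant for rows \<open>E\<close> outside the window supporting \<open>v\<close>. Entries
  of \<open>v\<close> in \<open>A\<close> are charged in full; the others reach \<open>E\<close>
  only through coefficients of \<open>g\<close> with index in \<open>T\<close>, whose total is
  small.\<close>

lemma Mult_edge_estimate:
  assumes g: "in_l1 g" and v: "l2_le v B" and T: "l1_norm (restr T g) \<le> e" and A: "finite A"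
    and far: "\<And>k i. k \<in> E \<Longrightarrow> i \<notin> A \<Longrightarrow> v i \<noteq> 0 \<Longrightarrow> k - i \<in> T"
  shows "l2_le (restr E (Mult g v)) (l1_norm g * L2_set (\<lambda>j. cmod (v j)) A + e * B)"
proof (rule l2_le_add)
  define a b where "a = restr A v" and "b = restr (- A) v"
  have b: "l2_le b B" unfolding b_def by (rule l2_le_restr[OF v])
  have "l2_le a (L2_set (\<lambda>j. cmod (a j)) A)"
    by (rule l2_le_finite_support[OF A]) (simp add: a_def restr_def)
  also have "L2_set (\<lambda>j. cmod (a j)) A = L2_set (\<lambda>j. cmod (v j)) A"
    by (rule L2_set_cong) (auto simp: a_def restr_def)
  finally have a: "l2_le a (L2_set (\<lambda>j. cmod (v j)) A)" .
  show "l2_le (Mult g a) (l1_norm g * L2_set (\<lambda>j. cmod (v j)) A)"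
    by (rule l2_le_Mult[OF g a])
  show "l2_le (Mult (restr T g) b) (e * B)"
    by (rule l2_le_mono[OF l2_le_Mult[OF in_l1_restr[OF g] b]])
       (intro mult_right_mono T l2_le_nonneg[OF v])
  fix k
  show "cmod (restr E (Mult g v) k) \<le> cmod (Mult g a k) + cmod (Mult (restr T g) b k)"
  proof (cases "k \<in> E")
    case True
    have "Mult g v k = Mult g a k + Mult g b k"
      using Mult_add_right[of g a _ b B k, OF g l2_le_bound[OF a] l2_le_bound[OF b]]
      unfolding a_def b_def restr_split .
    also have "Mult g b k = Mult (restr T g) b k"
      unfolding Mult_def
    proof (rule infsum_cong)
      fix j show "g j * b (k - j) = restr T g j * b (k - j)"
        using far[OF True, of "k - j"] by (auto simp: b_def restr_def)
    qed
    finally show ?thesis using True by (simp add: restr_def norm_triangle_ineq)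
  qed (simp add: restr_def)
qed

text \<open>\<open>ker1\<close> belongs to the right end of the window. Seen from the left end the
  section acts on indices \<open>j \<ge> 0\<close>, and the reflection of \<open>j\<close> to
  \<open>-1 - j\<close> identifies the kernel in \<open>ker2\<close> with that of the
  transpose.\<close>

lemma finite_sections_stable:
  assumes g: "in_l1 g" and d: "d > 0" "\<And>z. cmod z = 1 \<Longrightarrow> cmod (lval g z) \<ge> d"
    and ker1: "\<And>x B. l2_le x B \<Longrightarrow> (\<And>j. j \<ge> 0 \<Longrightarrow> x j = 0) \<Longrightarrow>
                 (\<And>k. k < 0 \<Longrightarrow> Mult g x k = 0) \<Longrightarrow> (\<And>j. x j = 0)"
    and ker2: "\<And>y B. l2_le y B \<Longrightarrow> (\<And>j. j < 0 \<Longrightarrow> y j = 0) \<Longrightarrow>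
                 (\<And>k. k \<ge> 0 \<Longrightarrow> Mult g y k = 0) \<Longrightarrow> (\<And>j. y j = 0)"
  shows "\<exists>\<kappa>>0. \<exists>M0. \<forall>M\<ge>M0. \<forall>v. (\<forall>j. j \<notin> {-M..-1} \<longrightarrow> v j = 0) \<longrightarrow>
           L2_set (\<lambda>j. cmod (v j)) {-M..-1} \<le> \<kappa> * L2_set (\<lambda>j. cmod (Mult g v j)) {-M..-1}"
proof (rule ccontr)
  assume contra: "\<not> ?thesis"
  \<comment> \<open>The negated claim is taken with constant \<open>n + 1\<close> and threshold
    \<open>n\<close>, and the resulting vector is normalised.\<close>
  have "\<exists>M v. M \<ge> int n \<and> (\<forall>j. j \<notin> {-M..-1} \<longrightarrow> v j = 0) \<and> L2_set (\<lambda>j. cmod (v j)) {-M..-1} = 1 \<and>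
          L2_set (\<lambda>j. cmod (Mult g v j)) {-M..-1} \<le> inverse (real (Suc n))" for n
  proof -
    have "real (Suc n) > 0" by simp
    then obtain M v where Mv: "M \<ge> int n" "\<forall>j. j \<notin> {-M..-1} \<longrightarrow> v j = 0"
      and gt: "\<not> L2_set (\<lambda>j. cmod (v j)) {-M..-1} \<le> real (Suc n) * L2_set (\<lambda>j. cmod (Mult g v j)) {-M..-1}"
      using contra by blast
    define L where "L = L2_set (\<lambda>j. cmod (v j)) {-M..-1}"
    define w where "w = (\<lambda>j. complex_of_real (inverse L) * v j)"
    have L: "real (Suc n) * L2_set (\<lambda>j. cmod (Mult g v j)) {-M..-1} < L"
      using gt unfolding L_def by linarith
    have L0: "L > 0"
      by (rule le_less_trans[OF _ L]) simp
    have w: "L2_set (\<lambda>j. cmod (w j)) {-M..-1} = inverse L * L"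
    proof -
      have "cmod (w j) = inverse L * cmod (v j)" for j
        using L0 by (simp add: w_def norm_mult norm_inverse)
      then show ?thesis
        using L2_set_right_distrib[of "inverse L" "\<lambda>j. cmod (v j)" "{-M..-1}"] L0
        by (simp add: L_def[symmetric])
    qed
    have "Mult g w j = complex_of_real (inverse L) * Mult g v j" for j
      unfolding w_def by (rule Mult_cmult_right)
    then have "cmod (Mult g w j) = inverse L * cmod (Mult g v j)" for j
      using L0 by (simp add: norm_mult norm_inverse)
    then have "L2_set (\<lambda>j. cmod (Mult g w j)) {-M..-1} =
        inverse L * L2_set (\<lambda>j. cmod (Mult g v j)) {-M..-1}"
      using L2_set_right_distrib[of "inverse L" "\<lambda>j. cmod (Mult g v j)" "{-M..-1}"] L0 by simp
    also have "\<dots> \<le> inverse (real (Suc n))"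
      using L L0 by (simp add: field_simps)
    finally show ?thesis
      using w L0 Mv by (intro exI[of _ M] exI[of _ w]) (auto simp: w_def)
  qed
  then obtain M v where M: "\<And>n. M n \<ge> int n" and v0: "\<And>n j. j \<notin> {-M n..-1} \<Longrightarrow> v n j = 0"
    and v1: "\<And>n. L2_set (\<lambda>j. cmod (v n j)) {-M n..-1} = 1"
    and gv: "\<And>n. L2_set (\<lambda>j. cmod (Mult g (v n) j)) {-M n..-1} \<le> inverse (real (Suc n))"
    by metis
  have vl: "l2_le (v n) 1" for n
    using l2_le_finite_support[of "{-M n..-1}" "v n"] v0 v1 by simp
  \<comment> \<open>The flag selects the view: \<open>True\<close> keeps the right end at
    \<open>-1\<close>, \<open>False\<close> moves the left end to \<open>0\<close>. Joining both
    views in one countable index set gives a common convergent subsequence.\<close>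
  define f where "f n p = (if fst p then v n (snd p) else v n (snd p - M n))" for n and p :: "bool \<times> int"
  have "norm (f n p) \<le> 1" for n p
    unfolding f_def using l2_le_bound[OF vl] by simp
  then obtain r where r: "strict_mono r" and fr: "\<And>p. \<exists>l. (\<lambda>n. f (r n) p) \<longlonglongrightarrow> l"
    using function_convergent_subsequence[of UNIV f 1] by (metis UNIV_I countableI_type)
  define V m where "V n = v (r n)" and "m n = M (r n)" for n
  define V' where "V' n j = V n (j - m n)" for n j
  have rn: "n \<le> r n" for n using seq_suble[OF r] .
  have m: "m n \<ge> int n" for n using M[of "r n"] rn[of n] unfolding m_def by linarith
  have V0: "V n j = 0" if "j \<notin> {-m n..-1}" for n j using v0 that unfolding V_def m_def by auto
  have V1: "L2_set (\<lambda>j. cmod (V n j)) {-m n..-1} = 1" for n unfolding V_def m_def by (rule v1)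
  have Vl: "l2_le (V n) 1" for n unfolding V_def by (rule vl)
  have Vl': "l2_le (V' n) 1" for n unfolding V'_def by (rule l2_le_shift[OF Vl])
  have gV: "L2_set (\<lambda>j. cmod (Mult g (V n) j)) {-m n..-1} \<le> inverse (real (Suc n))" for n
    unfolding V_def m_def by (rule order_trans[OF gv]) (use rn in simp)
  have gVj: "cmod (Mult g (V n) j) \<le> inverse (real (Suc n))" if "j \<in> {-m n..-1}" for n j
    by (rule order_trans[OF member_le_L2_set gV]) (use that in auto)
  have "\<exists>l. (\<lambda>n. V n j) \<longlonglongrightarrow> l" for j
    using fr[of "(True, j)"] by (simp add: f_def V_def)
  then obtain x where x: "\<And>j. (\<lambda>n. V n j) \<longlonglongrightarrow> x j" by metis
  have "\<exists>l. (\<lambda>n. V' n j) \<longlonglongrightarrow> l" for j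
    using fr[of "(False, j)"] by (simp add: f_def V_def V'_def m_def)
  then obtain y where y: "\<And>j. (\<lambda>n. V' n j) \<longlonglongrightarrow> y j" by metis
  have x0: "x j = 0" for j
  proof (rule ker1)
    show "l2_le x 1" by (rule l2_le_limit[OF Vl x])
    show "x j = 0" if "j \<ge> 0" for j
    proof -
      have "V n j = 0" for n using that by (intro V0) auto
      then show ?thesis using x[of j] by (simp add: LIMSEQ_const_iff)
    qed
    fix k :: int assume k: "k < 0"
    \<comment> \<open>A fixed row \<open>k < 0\<close> lies in the window as soon as
      \<open>n \<ge> -k\<close>, and there the product is small.\<close>
    have "(\<lambda>n. Mult g (V n) k) \<longlonglongrightarrow> 0"
    proof (rule Lim_null_comparison[OF _ LIMSEQ_inverse_real_of_nat])
      show "\<forall>\<^sub>F n in sequentially. cmod (Mult g (V n) k) \<le> inverse (real (Suc n))"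
        using eventually_ge_at_top[of "nat (- k)"]
      proof eventually_elim
        case (elim n)
        then show ?case using k m[of n] by (intro gVj) auto
      qed
    qed
    then show "Mult g x k = 0"
      using LIMSEQ_unique[OF Mult_tendsto[of g V 1 x k, OF g l2_le_bound[OF Vl] x]] by simp
  qed
  have y0: "y j = 0" for j
  proof (rule ker2)
    show "l2_le y 1" by (rule l2_le_limit[OF Vl' y])
    show "y j = 0" if "j < 0" for j
    proof -
      have "V' n j = 0" for n unfolding V'_def using that by (intro V0) auto
      then show ?thesis using y[of j] by (simp add: LIMSEQ_const_iff)
    qed
    fix k :: int assume k: "k \<ge> 0"
    have eq: "Mult g (V' n) k = Mult g (V n) (k - m n)" for n
      unfolding V'_def by (rule Mult_shift)
    \<comment> \<open>Row \<open>k\<close> of the shifted product is row \<open>k - m n\<close> of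
      the original one, inside the window once \<open>n > k\<close>.\<close>
    have "(\<lambda>n. Mult g (V' n) k) \<longlonglongrightarrow> 0"
    proof (rule Lim_null_comparison[OF _ LIMSEQ_inverse_real_of_nat])
      show "\<forall>\<^sub>F n in sequentially. cmod (Mult g (V' n) k) \<le> inverse (real (Suc n))"
        using eventually_gt_at_top[of "nat k"]
      proof eventually_elim
        case (elim n)
        then show ?case unfolding eq using k m[of n] by (intro gVj) auto
      qed
    qed
    then show "Mult g y k = 0"
      using LIMSEQ_unique[OF Mult_tendsto[of g V' 1 y k, OF g l2_le_bound[OF Vl'] y]] by simp
  qed
  \<comment> \<open>Each of the two edges will contribute \<open>d / 4\<close>, so that the limit of
    \<open>bound\<close> reads \<open>d \<le> d / 2\<close>.\<close>
  have "d / 4 > 0" using d by simp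
  then obtain A0 where A0: "finite A0" "\<And>S. S \<inter> A0 = {} \<Longrightarrow> l1_norm (restr S g) \<le> d / 4"
    using l1_tail[OF g] by blast
  define K where "K = Max (insert 0 (abs ` A0))"
  have "\<bar>j\<bar> \<le> K" if "j \<in> A0" for j
    unfolding K_def using A0 that by (intro Max_ge) auto
  then have tail: "l1_norm (restr (- {-K..K}) g) \<le> d / 4"
    by (intro A0(2)) fastforce
  define a where "a n = L2_set (\<lambda>j. cmod (V n j)) {-K..-1}" for n
  define b where "b n = L2_set (\<lambda>j. cmod (V' n j)) {0..K}" for n
  have "a \<longlonglongrightarrow> sqrt (\<Sum>j\<in>{-K..-1}. (cmod (x j))\<^sup>2)"
    unfolding a_def L2_set_def by (intro tendsto_intros x)
  then have a: "a \<longlonglongrightarrow> 0" by (simp add: x0)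
  have "b \<longlonglongrightarrow> sqrt (\<Sum>j\<in>{0..K}. (cmod (y j))\<^sup>2)"
    unfolding b_def L2_set_def by (intro tendsto_intros y)
  then have b: "b \<longlonglongrightarrow> 0" by (simp add: y0)
  define G where "G = l1_norm g"
  \<comment> \<open>The product is cut into the rows of the window, right of it and left of it. An
    outer row sees entries farther than \<open>K\<close> from the adjacent end only through
    coefficients of \<open>g\<close> with index outside \<open>{-K..K}\<close>.\<close>
  have bound: "d \<le> inverse (real (Suc n)) + ((G * a n + d / 4 * 1) + (G * b n + d / 4 * 1))" for n
  proof -
    let ?h = "Mult g (V n)"
    have far1: "k - i \<in> - {-K..K}" if "k \<in> {0..}" "i \<notin> {-K..-1}" "V n i \<noteq> 0" for k i
      using that V0[of i n] by auto
    have e1: "l2_le (restr {0..} ?h) (G * a n + d / 4 * 1)"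
      unfolding G_def a_def by (rule Mult_edge_estimate[OF g Vl tail _ far1]) auto
    have far2: "k - i \<in> - {-K..K}" if "k \<in> {..<-m n}" "i \<notin> {-m n..-m n + K}" "V n i \<noteq> 0" for k i
      using that V0[of i n] by auto
    have "b n = L2_set (\<lambda>j. cmod (V n j)) ((\<lambda>j. j - m n) ` {0..K})"
      unfolding b_def V'_def L2_set_def by (subst sum.reindex) (auto simp: inj_on_def)
    also have "(\<lambda>j. j - m n) ` {0..K} = {-m n..-m n + K}"
      by (auto intro!: image_eqI[where x="_ + m n"])
    finally have bn: "b n = L2_set (\<lambda>j. cmod (V n j)) {-m n..-m n + K}" .
    have e2: "l2_le (restr {..<-m n} ?h) (G * b n + d / 4 * 1)"
      unfolding G_def bn by (rule Mult_edge_estimate[OF g Vl tail _ far2]) auto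
    have "l2_le (restr {-m n..-1} ?h) (L2_set (\<lambda>j. cmod (restr {-m n..-1} ?h j)) {-m n..-1})"
      by (rule l2_le_finite_support) (auto simp: restr_def)
    also have "L2_set (\<lambda>j. cmod (restr {-m n..-1} ?h j)) {-m n..-1} = L2_set (\<lambda>j. cmod (?h j)) {-m n..-1}"
      by (rule L2_set_cong) (auto simp: restr_def)
    finally have e0: "l2_le (restr {-m n..-1} ?h) (inverse (real (Suc n)))"
      using gV l2_le_mono by blast
    have "l2_le (\<lambda>j. restr {0..} ?h j + restr {..<-m n} ?h j) ((G * a n + d / 4 * 1) + (G * b n + d / 4 * 1))"
      by (rule l2_le_add[OF e1 e2]) (rule norm_triangle_ineq)
    then have "l2_le ?h (inverse (real (Suc n)) + ((G * a n + d / 4 * 1) + (G * b n + d / 4 * 1)))"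
    proof (rule l2_le_add[OF e0])
      show "cmod (?h j) \<le> cmod (restr {-m n..-1} ?h j) + cmod (restr {0..} ?h j + restr {..<-m n} ?h j)" for j
        using m[of n] by (auto simp: restr_def)
    qed
    then have "d * L2_set (\<lambda>j. cmod (V n j)) {-m n..-1}
        \<le> inverse (real (Suc n)) + ((G * a n + d / 4 * 1) + (G * b n + d / 4 * 1))"
      by (intro Mult_lower_bound[OF g d _ V0]) auto
    then show ?thesis using V1[of n] by simp
  qed
  have "(\<lambda>n. inverse (real (Suc n)) + ((G * a n + d / 4 * 1) + (G * b n + d / 4 * 1)))
      \<longlonglongrightarrow> 0 + ((G * 0 + d / 4 * 1) + (G * 0 + d / 4 * 1))"
    by (intro tendsto_intros a b LIMSEQ_inverse_real_of_nat)
  then have "d \<le> 0 + ((G * 0 + d / 4 * 1) + (G * 0 + d / 4 * 1))"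
    by (rule LIMSEQ_le_const) (use bound in blast)
  then show False using d by simp
qed

section \<open>Finite-dimensional surjectivity and weighted norms\<close>

text \<open>An injective linear map of a finite-dimensional space into itself is onto. Linearity is
  asked on all sequences because the ambient vector space is the whole type, with \<open>V\<close>
  as a subspace.\<close>

lemma finite_support_bij:
  fixes f :: "lcoef \<Rightarrow> lcoef" and S :: "int set"
  defines "V \<equiv> {v. \<forall>j. j \<notin> S \<longrightarrow> v j = 0}"
  assumes S: "finite S" and fV: "\<And>v. f v \<in> V"
    and add: "\<And>u v j. f (\<lambda>j. u j + v j) j = f u j + f v j"
    and scale: "\<And>a v j. f (\<lambda>j. a * v j) j = a * f v j"
    and ker: "\<And>v j. v \<in> V \<Longrightarrow> (\<And>j. f v j = 0) \<Longrightarrow> v j = 0"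
  shows "bij_betw f V V"
proof -
  define sc :: "complex \<Rightarrow> lcoef \<Rightarrow> lcoef" where "sc = (\<lambda>a v j. a * v j)"
  interpret vs: vector_space sc
    by unfold_locales (auto simp: sc_def fun_eq_iff algebra_simps)
  interpret f: Vector_Spaces.linear sc sc f
    by unfold_locales (auto simp: sc_def fun_eq_iff plus_fun_def add scale)
  have sub: "vs.subspace V"
    unfolding vs.subspace_def by (auto simp: V_def sc_def)
  define E where "E = (\<lambda>i j. if j = i then 1 else 0 :: complex) ` S"
  have VE: "v \<in> vs.span E" if "v \<in> V" for v
  proof -
    have "T \<subseteq> S \<Longrightarrow> restr T v \<in> vs.span E" if "finite T" for T
      using that
    proof (induction T rule: finite_induct)
      case empty
      have 0: "restr {} v = 0" by (auto simp: restr_def fun_eq_iff)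
      show ?case unfolding 0 by (rule vs.span_zero)
    next
      case (insert i T)
      have eq: "restr (insert i T) v = sc (v i) (\<lambda>j. if j = i then 1 else 0) + restr T v"
        using insert by (auto simp: restr_def sc_def fun_eq_iff)
      have "(\<lambda>j. if j = i then 1 else 0) \<in> vs.span E"
        using insert by (intro vs.span_base) (auto simp: E_def)
      then show ?case
        unfolding eq using insert by (intro vs.span_add vs.span_scale) auto
    qed
    from this[OF S] have "restr S v \<in> vs.span E" by simp
    moreover have "restr S v = v" using that by (auto simp: restr_def V_def fun_eq_iff)
    ultimately show ?thesis by simp
  qed
  obtain B where B: "B \<subseteq> V" "vs.independent B" "V \<subseteq> vs.span B"
    by (rule vs.basis_exists[of V])
  have "finite E" using S by (simp add: E_def)
  moreover have "B \<subseteq> vs.span E" using B(1) VE by blast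
  ultimately have "finite B" using vs.independent_span_bound[OF _ B(2)] by simp
  have spB: "vs.span B = V"
    by (rule subset_antisym[OF vs.span_minimal[OF B(1) sub] B(3)])
  have inj: "inj_on f V"
  proof (rule inj_onI)
    fix u v assume uv: "u \<in> V" "v \<in> V" "f u = f v"
    have "(u - v) j = 0" for j
    proof (rule ker)
      show "u - v \<in> V" by (rule vs.subspace_diff[OF sub uv(1,2)])
      show "f (u - v) j = 0" for j using uv by (simp add: f.diff)
    qed
    then show "u = v" by (auto simp: fun_eq_iff)
  qed
  have ind: "vs.independent (f ` B)"
    using f.independent_injective_image[OF B(2)] inj spB by simp
  \<comment> \<open>A vector of \<open>V\<close> outside this span would extend the image of
    \<open>B\<close> to \<open>card B + 1\<close> independent vectors inside the span of
    \<open>B\<close>.\<close>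
  have "V \<subseteq> vs.span (f ` B)"
  proof (rule ccontr)
    assume "\<not> ?thesis"
    then obtain y where y: "y \<in> V" "y \<notin> vs.span (f ` B)" by blast
    then have "vs.independent (insert y (f ` B))"
      using vs.independent_insertI[OF y(2) ind] by simp
    moreover have "insert y (f ` B) \<subseteq> vs.span B"
      using y fV spB by auto
    ultimately have "card (insert y (f ` B)) \<le> card B"
      using vs.independent_span_bound[OF \<open>finite B\<close>] by simp
    moreover have "y \<notin> f ` B" using y(2) vs.span_base[of y "f ` B"] by auto
    moreover have "card (f ` B) = card B"
      by (rule card_image[OF inj_on_subset[OF inj B(1)]])
    ultimately show False using \<open>finite B\<close> by simp
  qed
  then have "V \<subseteq> f ` V" by (simp add: f.span_image spB)
  then show ?thesis using inj fV by (auto simp: bij_betw_def)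
qed

section \<open>Sobolev weights and their reduction to l2\<close>

abbreviation wt :: "int \<Rightarrow> real" where "wt j \<equiv> max 1 \<bar>real_of_int j\<bar>"

lemma summable_wt: "(\<lambda>j. wt j powr (-2)) summable_on UNIV"
proof -
  \<comment> \<open>The factor 4 comes from \<open>n + 1 \<le> 2 * wt j\<close>, which covers both
    \<open>j = n\<close>, including \<open>n = 0\<close>, and \<open>j = - n - 1\<close>.\<close>
  let ?h = "\<lambda>n::nat. 4 * inverse (real (Suc n) ^ 2)"
  have bnd: "wt j powr (-2) \<le> ?h n" if "real (Suc n) \<le> 2 * wt j" for j n
  proof -
    have "wt j powr (-2) = 4 * inverse ((2 * wt j) ^ 2)"
      by (simp add: powr_minus powr_numeral power_mult_distrib)
    also have "\<dots> \<le> ?h n"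
      using that by (intro mult_left_mono le_imp_inverse_le power_mono) auto
    finally show ?thesis .
  qed
  have "summable (\<lambda>n. inverse (real (Suc n) ^ 2))"
    using inverse_power_summable[of 2, where 'a=real] summable_Suc_iff[of "\<lambda>n. inverse (real n ^ 2)"] by simp
  then have "?h summable_on UNIV"
    by (subst summable_on_UNIV_nonneg_real_iff) (auto intro: summable_mult)
  then have comp: "(\<lambda>n. wt (p n) powr (-2)) summable_on UNIV" if "\<And>n. real (Suc n) \<le> 2 * wt (p n)" for p
    by (rule summable_on_comparison_test) (use bnd that in auto)
  have image: "(\<lambda>j. wt j powr (-2)) summable_on range p"
    if "inj p" "\<And>n. real (Suc n) \<le> 2 * wt (p n)" for p :: "nat \<Rightarrow> int"
    unfolding summable_on_reindex[OF that(1)] o_def by (rule comp[OF that(2)])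
  have "(\<lambda>j. wt j powr (-2)) summable_on range int"
    by (rule image) (auto simp: max_def)
  moreover have "(\<lambda>j. wt j powr (-2)) summable_on range (\<lambda>n. - int n - 1)"
    by (rule image) (auto simp: max_def inj_on_def)
  moreover have "(UNIV :: int set) = range int \<union> range (\<lambda>n. - int n - 1)"
  proof (intro set_eqI iffI)
    fix j :: int
    show "j \<in> range int \<union> range (\<lambda>n. - int n - 1)"
    proof (cases "j \<ge> 0")
      case True
      then have "j = int (nat j)" by simp
      then show ?thesis by blast
    next
      case False
      then have "j = - int (nat (- j - 1)) - 1" by simp
      then show ?thesis by blast
    qed
  qed simp
  ultimately show ?thesis using summable_on_union by metis
qed

text \<open>The modulus of \<open>u j\<close> is the product of its weighted value and
  \<open>wt j powr (- t)\<close>. A product is at most the sum of the squares, and both squares are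
  summable as \<open>t \<ge> 1\<close>.\<close>

lemma in_Hs_imp_in_l1:
  assumes "t \<ge> 1" "in_Hs t u"
  shows "in_l1 u"
proof (rule Infinite_Sum.abs_summable_on_comparison_test')
  show "(\<lambda>j. (cmod (u j))\<^sup>2 * wt j powr (2 * t) + wt j powr (-2)) summable_on UNIV"
    using assms(2) unfolding in_Hs_def by (intro summable_on_add summable_wt)
  fix j
  let ?a = "cmod (u j) * wt j powr t" and ?b = "wt j powr (- t)"
  have "?a * ?b \<le> ?a\<^sup>2 + ?b\<^sup>2"
    using sum_squares_bound[of ?a ?b] zero_le_power2[of ?a] zero_le_power2[of ?b] by linarith
  moreover have "?a * ?b = cmod (u j)" by (simp add: powr_minus)
  moreover have "?a\<^sup>2 = (cmod (u j))\<^sup>2 * wt j powr (2 * t)"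
    by (simp add: power_mult_distrib powr_power mult.commute)
  moreover have "?b\<^sup>2 \<le> wt j powr (-2)"
    using assms(1) by (simp add: powr_power powr_mono)
  ultimately show "cmod (u j) \<le> (cmod (u j))\<^sup>2 * wt j powr (2 * t) + wt j powr (-2)" by linarith
qed

text \<open>Turns the norm of order \<open>s\<close> into an l2 norm, so that \<open>l2_le\<close>
  serves for every order.\<close>

abbreviation weighted :: "real \<Rightarrow> lcoef \<Rightarrow> lcoef" where
  "weighted s u \<equiv> (\<lambda>j. complex_of_real (wt j powr s) * u j)"

lemma cmod_weighted_sq: "(cmod (weighted s u j))\<^sup>2 = (cmod (u j))\<^sup>2 * wt j powr (2 * s)"
  by (simp add: norm_mult power_mult_distrib powr_power mult.commute)

lemma in_Hs_imp_l2_le: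
  assumes "in_Hs s u"
  shows "\<exists>B. l2_le (weighted s u) B"
proof (intro exI)
  let ?I = "infsum (\<lambda>j. (cmod (u j))\<^sup>2 * wt j powr (2 * s)) UNIV"
  show "l2_le (weighted s u) (sqrt ?I)"
    unfolding l2_le_def L2_set_def cmod_weighted_sq
    by (intro allI impI real_sqrt_le_mono finite_sum_le_infsum) (use assms in \<open>auto simp: in_Hs_def\<close>)
qed

lemma l2_le_imp_in_Hs:
  assumes "l2_le (weighted s u) B"
  shows "in_Hs s u"
  using l2_le_summable[OF assms] unfolding cmod_weighted_sq in_Hs_def .

lemma l2_le_imp_Hs_norm:
  assumes "l2_le (weighted s u) B" "c \<bar>s\<bar> \<ge> 0"
  shows "Hs_norm c s u \<le> sqrt (c \<bar>s\<bar>) * B"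
proof -
  have "infsum (\<lambda>j. (cmod (u j))\<^sup>2 * wt j powr (2 * s)) UNIV \<le> B\<^sup>2"
  proof (rule infsum_le_finite_sums)
    show "(\<lambda>j. (cmod (u j))\<^sup>2 * wt j powr (2 * s)) summable_on UNIV"
      using l2_le_imp_in_Hs[OF assms(1)] by (simp add: in_Hs_def)
    show "(\<Sum>j\<in>F. (cmod (u j))\<^sup>2 * wt j powr (2 * s)) \<le> B\<^sup>2" if "finite F" for F
      using l2_le_sum_sq[OF assms(1) that] unfolding cmod_weighted_sq .
  qed
  then have "Hs_norm c s u \<le> sqrt (c \<bar>s\<bar> * B\<^sup>2)"
    unfolding Hs_norm_def using assms(2) by (intro real_sqrt_le_mono mult_left_mono)
  also have "\<dots> = sqrt (c \<bar>s\<bar>) * B"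
    using l2_le_nonneg[OF assms(1)] by (simp add: real_sqrt_mult)
  finally show ?thesis .
qed

lemma weighted_0: "weighted 0 u = u"
proof
  have "wt j \<noteq> 0" for j by linarith
  then show "weighted 0 u j = u j" for j by simp
qed

section \<open>The truncated operators\<close>

lemma PN_eq_restr: "PN N u = restr {-Nminus N..Nplus N} u"
  by (auto simp: PN_def restr_def fun_eq_iff)

lemma ranPN_eq: "ranPN N = {v. \<forall>j. j \<notin> {-Nminus N..Nplus N} \<longrightarrow> v j = 0}"
proof (intro set_eqI iffI)
  fix v :: lcoef assume v: "v \<in> {v. \<forall>j. j \<notin> {-Nminus N..Nplus N} \<longrightarrow> v j = 0}"
  then have "PN N v = v" by (auto simp: PN_def fun_eq_iff)
  then show "v \<in> ranPN N" unfolding ranPN_def by (metis rangeI)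
qed (auto simp: ranPN_def PN_eq_restr restr_def)

lemma PN_ranPN: "v \<in> ranPN N \<Longrightarrow> PN N v = v"
  by (auto simp: ranPN_eq PN_def fun_eq_iff)

lemma ranPN_l2_le: "v \<in> ranPN N \<Longrightarrow> \<exists>B. l2_le v B"
  using l2_le_finite_support[of "{-Nminus N..Nplus N}" v] by (auto simp: ranPN_eq)

lemma Cminus_ranPN: "v \<in> ranPN N \<Longrightarrow> Cminus v \<in> ranPN N"
  by (auto simp: ranPN_eq Cminus_def)

lemma AN_apply:
  assumes "v \<in> ranPN N"
  shows "AN N g v j = (if j \<in> {-Nminus N..Nplus N} then Cplus v j - Mult g (Cminus v) j else 0)"
proof -
  have "AN N g v = Cplus v - PN N (Mult g (Cminus v))"
    by (simp add: AN_def MN_def PN_ranPN[OF Cminus_ranPN[OF assms]])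
  then show ?thesis
    using assms by (auto simp: PN_def Cplus_def ranPN_eq)
qed

lemma l2_le_Cminus: "l2_le u B \<Longrightarrow> l2_le (Cminus u) B"
  by (erule l2_le_dominated) (simp add: Cminus_def)

lemma Mult_Cminus_add:
  assumes "in_l1 g" "l2_le u B" "l2_le v C"
  shows "Mult g (Cminus (\<lambda>j. u j + v j)) k = Mult g (Cminus u) k + Mult g (Cminus v) k"
proof -
  have "Cminus (\<lambda>j. u j + v j) = (\<lambda>j. Cminus u j + Cminus v j)"
    by (auto simp: Cminus_def fun_eq_iff)
  then show ?thesis
    using Mult_add_right[of g "Cminus u" B "Cminus v" C k, OF assms(1)
        l2_le_bound[OF l2_le_Cminus[OF assms(2)]] l2_le_bound[OF l2_le_Cminus[OF assms(3)]]] by simp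
qed

lemma Mult_Cminus_cmult: "Mult g (Cminus (\<lambda>j. a * u j)) k = a * Mult g (Cminus u) k"
proof -
  have "Cminus (\<lambda>j. a * u j) = (\<lambda>j. a * Cminus u j)"
    by (auto simp: Cminus_def fun_eq_iff)
  then show ?thesis by (simp add: Mult_cmult_right)
qed

lemma AN_add:
  assumes "in_l1 g" "u \<in> ranPN N" "v \<in> ranPN N"
  shows "AN N g (\<lambda>j. u j + v j) j = AN N g u j + AN N g v j"
proof -
  have uv: "(\<lambda>j. u j + v j) \<in> ranPN N" using assms by (auto simp: ranPN_eq)
  obtain B C where "l2_le u B" "l2_le v C" using assms ranPN_l2_le by blast
  then show ?thesis
    by (auto simp: AN_apply assms uv Mult_Cminus_add[OF assms(1)] Cplus_def)
qed

lemma AN_cmult: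
  assumes "u \<in> ranPN N"
  shows "AN N g (\<lambda>j. a * u j) j = a * AN N g u j"
proof -
  have "(\<lambda>j. a * u j) \<in> ranPN N" using assms by (auto simp: ranPN_eq)
  then show ?thesis
    by (auto simp: AN_apply assms Mult_Cminus_cmult Cplus_def algebra_simps)
qed

lemma AN_bij:
  assumes g: "in_l1 g" and inj: "\<And>v. v \<in> ranPN N \<Longrightarrow> (\<And>j. AN N g v j = 0) \<Longrightarrow> (\<And>j. v j = 0)"
  shows "bij_betw (AN N g) (ranPN N) (ranPN N)"
proof -
  \<comment> \<open>Composition with the projection keeps all values in \<open>ranPN N\<close> and
    makes the map linear on all sequences, as \<open>finite_support_bij\<close> requires.\<close>
  define f where "f v = AN N g (PN N v)" for v
  have ran: "PN N v \<in> ranPN N" for v by (simp add: ranPN_def)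
  have "bij_betw f (ranPN N) (ranPN N)"
    unfolding ranPN_eq
  proof (rule finite_support_bij, unfold ranPN_eq[symmetric])
    show "f v \<in> ranPN N" for v by (auto simp: f_def ranPN_eq AN_apply[OF ran])
    fix u v :: lcoef and j and a :: complex
    have "PN N (\<lambda>j. u j + v j) = (\<lambda>j. PN N u j + PN N v j)" by (auto simp: PN_def)
    then show "f (\<lambda>j. u j + v j) j = f u j + f v j"
      by (simp add: f_def AN_add[OF g ran ran])
    have "PN N (\<lambda>j. a * v j) = (\<lambda>j. a * PN N v j)" by (auto simp: PN_def)
    then show "f (\<lambda>j. a * v j) j = a * f v j"
      by (simp add: f_def AN_cmult[OF ran])
    show "v j = 0" if "v \<in> ranPN N" "\<And>j. f v j = 0"
      using inj[OF that(1)] that by (simp add: f_def PN_ranPN)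
  qed simp
  then show ?thesis
    by (rule bij_betw_cong[THEN iffD1, rotated]) (simp add: f_def PN_ranPN)
qed

text \<open>Continuing \<open>x\<close> by \<open>- Mult g x\<close> on the nonnegative modes gives
  a solution of the homogeneous problem. Added to \<open>u\<close> it yields another solution, so
  uniqueness makes it vanish.\<close>

lemma kernel_trivial:
  assumes g: "in_l1 g" and u: "RHP_sol g u" and uniq: "\<forall>v. RHP_sol g v \<longrightarrow> v = u"
    and x: "l2_le x B" "\<And>j. j \<ge> 0 \<Longrightarrow> x j = 0" "\<And>k. k < 0 \<Longrightarrow> Mult g x k = 0"
  shows "x j = 0"
proof (cases "j < 0")
  case True
  define w where "w j = (if j < 0 then x j else - Mult g x j)" for j
  obtain C where C: "l2_le u C"
    using u in_Hs_imp_l2_le[of 0 u] unfolding RHP_sol_def weighted_0 by blast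
  have w: "l2_le w (B + l1_norm g * B)"
    by (rule l2_le_add[OF x(1) l2_le_Mult[OF g x(1)]]) (auto simp: w_def)
  have "l2_le (\<lambda>j. u j + w j) (C + (B + l1_norm g * B))"
    by (rule l2_le_add[OF C w]) (rule norm_triangle_ineq)
  then have "in_Hs 0 (\<lambda>j. u j + w j)"
    by (intro l2_le_imp_in_Hs) (unfold weighted_0)
  moreover have "(Cplus (\<lambda>j. u j + w j) - Mult g (Cminus (\<lambda>j. u j + w j))) k = (g - one_c) k" for k
  proof -
    have "(g - one_c) k = Cplus u k - Mult g (Cminus u) k"
      using u unfolding RHP_sol_def by (metis minus_apply)
    moreover have "Cminus w = (\<lambda>j. (-1) * x j)"
      using x(2) by (auto simp: Cminus_def w_def fun_eq_iff)
    then have "Mult g (Cminus w) k = - Mult g x k"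
      using Mult_cmult_right[of g "-1" x k] by simp
    ultimately show ?thesis
      using x(3) by (simp add: Mult_Cminus_add[OF g C w]) (auto simp: Cplus_def w_def)
  qed
  ultimately have "RHP_sol g (\<lambda>j. u j + w j)"
    unfolding RHP_sol_def by blast
  then have "(\<lambda>j. u j + w j) = u" using uniq by blast
  then have "u j + w j = u j" by (rule fun_cong)
  then show ?thesis using True by (simp add: w_def)
qed (use x in auto)

text \<open>If \<open>g y\<close> has only negative modes, then so has \<open>\<phi>\<^sup>- g y = \<phi>\<^sup>+ y\<close>, which on the other
  hand has only nonnegative modes. As \<open>\<phi>\<^sup>- = 1 + O(1/z)\<close> is invertible as a formal series in
  \<open>1/z\<close>, this forces \<open>g y = 0\<close>.\<close>

lemma transposed_kernel_trivial:
  assumes g: "in_l1 g" and d: "d > 0" "\<And>z. cmod z = 1 \<Longrightarrow> cmod (lval g z) \<ge> d"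
    and u: "RHP_sol g u" "in_l1 u"
    and y: "l2_le y B" "\<And>j. j < 0 \<Longrightarrow> y j = 0" "\<And>k. k \<ge> 0 \<Longrightarrow> Mult g y k = 0"
  shows "y j = 0"
proof -
  \<comment> \<open>These are the Laurent coefficients of \<open>\<phi>\<close> on the two sides of
    the circle; the jump relation becomes \<open>Mult g m = p\<close>.\<close>
  define p m where "p = (\<lambda>j. one_c j + Cplus u j)" and "m = (\<lambda>j. one_c j + Cminus u j)"
  define h where "h = Mult g y"
  have one: "in_l1 one_c"
    by (rule finite_nonzero_values_imp_summable_on) (auto simp: one_c_def intro: finite_subset[of _ "{0}"])
  have cu: "in_l1 (Cminus u)"
    by (rule Infinite_Sum.abs_summable_on_comparison_test[OF u(2)]) (auto simp: Cminus_def)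
  have ub: "cmod (Cminus u j) \<le> l1_norm u" for j
  proof -
    have "cmod (Cminus u j) \<le> (\<Sum>j\<in>{j}. cmod (u j))" by (simp add: Cminus_def)
    also have "\<dots> \<le> l1_norm u"
      unfolding l1_norm_def by (rule finite_sum_le_infsum[OF u(2)]) auto
    finally show ?thesis .
  qed
  have ob: "cmod (one_c j) \<le> 1" for j by (simp add: one_c_def)
  have ml: "in_l1 m"
    by (rule Infinite_Sum.abs_summable_on_comparison_test'[OF summable_on_add[OF one cu]])
       (auto simp: m_def norm_triangle_ineq)
  have "Mult g m = p"
  proof
    fix k
    have "Mult g m k = Mult g one_c k + Mult g (Cminus u) k"
      unfolding m_def by (rule Mult_add_right[of g one_c 1 "Cminus u" "l1_norm u" k, OF g ob ub])
    also have "Mult g one_c k = g k"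
      unfolding Mult_commute[of g]
      by (subst Mult_finite_support[of "{0}"]) (auto simp: one_c_def)
    also have "Mult g (Cminus u) k = one_c k + Cplus u k - g k"
    proof -
      have "(Cplus u - Mult g (Cminus u)) k = (g - one_c) k"
        using u(1) unfolding RHP_sol_def by simp
      then show ?thesis by (simp add: algebra_simps)
    qed
    finally show "Mult g m k = p k" by (simp add: p_def)
  qed
  \<comment> \<open>By associativity \<open>m (g y) = (m g) y = p y\<close>, and both
    \<open>p\<close> and \<open>y\<close> have only nonnegative modes.\<close>
  then have mh: "Mult m h = Mult p y"
    unfolding h_def using Mult_assoc[of m g y B, OF ml g l2_le_bound[OF y(1)]]
    by (simp add: Mult_commute[of m])
  have mh0: "Mult m h k = 0" if "k < 0" for k
  proof -
    have "p j * y (k - j) = 0" for j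
      using that y(2)[of "k - j"] by (cases "j \<ge> 0") (auto simp: p_def one_c_def Cplus_def)
    then show ?thesis unfolding mh unfolding Mult_def by (intro infsum_0) auto
  qed
  \<comment> \<open>Here \<open>m\<close> has no positive modes and \<open>m 0 = 1\<close>. Mode
    \<open>-n\<close> of \<open>Mult m h\<close> thus consists of \<open>h (- n)\<close> and terms
    with modes of \<open>h\<close> above \<open>-n\<close>, which vanish by induction or by the
    hypothesis on \<open>y\<close>.\<close>
  have hneg: "h (- int n) = 0" for n
  proof (induction n rule: less_induct)
    case (less n)
    show ?case
    proof (cases "n = 0")
      case False
      have "m j * h (- int n - j) = 0" if "j \<noteq> 0" for j
      proof (cases "j < 0")
        case True
        show ?thesis
        proof (cases "- int n - j \<ge> 0")
          case True
          then show ?thesis using y(3) by (simp add: h_def)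
        next
          case False
          then have "h (- int (nat (int n + j))) = 0" using \<open>j < 0\<close> by (intro less) auto
          moreover have "- int (nat (int n + j)) = - int n - j" using False by simp
          ultimately show ?thesis by simp
        qed
      qed (use that in \<open>simp add: m_def one_c_def Cminus_def\<close>)
      then have "Mult m h (- int n) = (\<Sum>\<^sub>\<infinity>j\<in>{0}. m j * h (- int n - j))"
        unfolding Mult_def by (intro infsum_cong_neutral) auto
      then show ?thesis using mh0[of "- int n"] False by (simp add: m_def one_c_def Cminus_def)
    qed (use y(3) in \<open>simp add: h_def\<close>)
  qed
  have "h k = 0" for k
    using hneg[of "nat (- k)"] y(3)[of k] by (cases "k \<ge> 0") (auto simp: h_def)
  then show ?thesis
    by (intro Mult_injective[OF g d y(1)]) (auto simp: h_def)
qed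

text \<open>The negative rows involve only the negative part \<open>q\<close> of \<open>v\<close>
  and form a finite section of the Toeplitz operator, which controls \<open>q\<close>. The
  nonnegative rows then give \<open>v j\<close> as row \<open>j\<close> of \<open>AN N g v\<close>
  minus \<open>Mult g q j\<close>.\<close>

lemma AN_stable:
  assumes g: "in_l1 g" and d: "d > 0" "\<And>z. cmod z = 1 \<Longrightarrow> cmod (lval g z) \<ge> d"
    and u: "RHP_sol g u" "in_l1 u" and uniq: "\<forall>v. RHP_sol g v \<longrightarrow> v = u"
  shows "\<exists>\<kappa>>0. \<exists>N0. \<forall>N\<ge>N0. \<forall>v\<in>ranPN N. \<forall>B. l2_le (AN N g v) B \<longrightarrow> l2_le v (\<kappa> * B)"
proof -
  have "\<exists>\<kappa>>0. \<exists>M0. \<forall>M\<ge>M0. \<forall>v. (\<forall>j. j \<notin> {-M..-1} \<longrightarrow> v j = 0) \<longrightarrow>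
           L2_set (\<lambda>j. cmod (v j)) {-M..-1} \<le> \<kappa> * L2_set (\<lambda>j. cmod (Mult g v j)) {-M..-1}"
  proof (rule finite_sections_stable[OF g d])
    show "x j = 0" if "l2_le x B" "\<And>j. 0 \<le> j \<Longrightarrow> x j = 0" "\<And>k. k < 0 \<Longrightarrow> Mult g x k = 0" for x B j
      by (rule kernel_trivial[OF g u(1) uniq that])
    show "y j = 0" if "l2_le y B" "\<And>j. j < 0 \<Longrightarrow> y j = 0" "\<And>k. 0 \<le> k \<Longrightarrow> Mult g y k = 0" for y B j
      by (rule transposed_kernel_trivial[OF g d u that])
  qed
  then obtain \<kappa> M0 where \<kappa>: "\<kappa> > 0" and stable: "\<And>M v. M \<ge> M0 \<Longrightarrow> (\<And>j. j \<notin> {-M..-1} \<Longrightarrow> v j = 0) \<Longrightarrow>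
       L2_set (\<lambda>j. cmod (v j)) {-M..-1} \<le> \<kappa> * L2_set (\<lambda>j. cmod (Mult g v j)) {-M..-1}"
    by blast
  define K where "K = 1 + l1_norm g * \<kappa> + \<kappa>"
  have "l2_le v (K * B)" if N: "N \<ge> nat (2 * M0)" and v: "v \<in> ranPN N" and B: "l2_le (AN N g v) B" for N v B
  proof -
    define M where "M = Nminus N"
    define q where "q = restr {-M..-1} v"
    have M: "M \<ge> M0" using N unfolding M_def Nminus_def by linarith
    \<comment> \<open>The value \<open>-1\<close> occurs at \<open>N = 0\<close>; in every case the
      whole range \<open>{-M..-1}\<close> lies in the window.\<close>
    have Np: "Nplus N \<ge> -1" unfolding Nplus_def by auto
    have "Cminus v = (\<lambda>j. (-1) * q j)"
      using v by (auto simp: Cminus_def q_def restr_def ranPN_eq fun_eq_iff M_def)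
    then have Mq: "Mult g (Cminus v) k = - Mult g q k" for k
      using Mult_cmult_right[of g "-1" q k] by simp
    have "L2_set (\<lambda>j. cmod (q j)) {-M..-1} \<le> \<kappa> * L2_set (\<lambda>j. cmod (Mult g q j)) {-M..-1}"
      by (rule stable[OF M]) (auto simp: q_def restr_def)
    also have "L2_set (\<lambda>j. cmod (Mult g q j)) {-M..-1} = L2_set (\<lambda>j. cmod (AN N g v j)) {-M..-1}"
      using Np by (intro L2_set_cong) (auto simp: AN_apply[OF v] Mq Cplus_def M_def)
    also have "\<kappa> * \<dots> \<le> \<kappa> * B"
      using \<kappa> by (intro mult_left_mono l2_leD[OF B]) auto
    finally have "L2_set (\<lambda>j. cmod (q j)) {-M..-1} \<le> \<kappa> * B" .
    moreover have "l2_le q (L2_set (\<lambda>j. cmod (q j)) {-M..-1})"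
      by (rule l2_le_finite_support) (auto simp: q_def restr_def)
    ultimately have q: "l2_le q (\<kappa> * B)" using l2_le_mono by blast
    have 1: "l2_le (restr {0..} v) (B + l1_norm g * (\<kappa> * B))"
    proof (rule l2_le_add[OF B l2_le_Mult[OF g q]])
      fix j
      show "cmod (restr {0..} v j) \<le> cmod (AN N g v j) + cmod (Mult g q j)"
      proof (cases "j \<ge> 0 \<and> j \<le> Nplus N")
        case True
        have "AN N g v j = v j + Mult g q j"
          using True by (auto simp: AN_apply[OF v] Mq Cplus_def Nminus_def)
        then show ?thesis
          using True norm_triangle_ineq4[of "v j + Mult g q j" "Mult g q j"] by (simp add: restr_def)
      next
        case False
        then show ?thesis using v by (auto simp: restr_def ranPN_eq)
      qed
    qed
    have "l2_le v ((B + l1_norm g * (\<kappa> * B)) + \<kappa> * B)"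
      by (rule l2_le_add[OF 1 q]) (use v in \<open>auto simp: restr_def q_def ranPN_eq M_def\<close>)
    then show ?thesis unfolding K_def by (simp add: algebra_simps)
  qed
  moreover have "K > 0" unfolding K_def using \<kappa> l1_norm_nonneg[of g] by (simp add: add_pos_nonneg)
  ultimately show ?thesis by blast
qed

section \<open>Error estimate\<close>

lemma wt_outside_window:
  assumes "j \<notin> {-Nminus N..Nplus N}"
  shows "real N / 2 \<le> wt j"
proof -
  have "real N \<le> 2 * \<bar>real_of_int j\<bar>"
  proof -
    have "int N \<le> 2 * \<bar>j\<bar>"
      using assms unfolding Nminus_def Nplus_def by auto
    then show ?thesis by linarith
  qed
  then show ?thesis by linarith
qed

lemma wt_inside_window:
  assumes "j \<in> {-Nminus N..Nplus N}" "N \<ge> 1"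
  shows "wt j \<le> real N"
proof -
  have "\<bar>j\<bar> \<le> int N"
    using assms unfolding Nminus_def Nplus_def by auto
  then have "\<bar>real_of_int j\<bar> \<le> real N" by linarith
  then show ?thesis using assms(2) by simp
qed

text \<open>Outside the window \<open>wt j \<ge> N / 2\<close>, and \<open>s - t\<close> is a
  nonpositive exponent, so trading weight \<open>t\<close> for weight \<open>s\<close> gains the
  stated factor.\<close>

lemma truncation_error:
  assumes u: "l2_le (weighted t u) U" and st: "s \<le> t" and N: "N \<ge> 1"
  shows "l2_le (weighted s (restr (- {-Nminus N..Nplus N}) u)) ((real N / 2) powr (s - t) * U)"
proof -
  define a where "a = (real N / 2) powr (s - t)"
  have "l2_le (\<lambda>j. complex_of_real a * weighted t u j) (cmod (complex_of_real a) * U)"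
    by (rule l2_le_cmult[OF u])
  also have "cmod (complex_of_real a) = a" by (simp add: a_def)
  finally have "l2_le (\<lambda>j. complex_of_real a * weighted t u j) (a * U)" .
  then show ?thesis
    unfolding a_def[symmetric]
  proof (rule l2_le_dominated)
    fix j
    show "cmod (weighted s (restr (- {-Nminus N..Nplus N}) u) j) \<le> cmod (complex_of_real a * weighted t u j)"
    proof (cases "j \<in> {-Nminus N..Nplus N}")
      case False
      have "wt j powr s = wt j powr (s - t) * wt j powr t"
        by (simp add: powr_add[symmetric])
      also have "\<dots> \<le> a * wt j powr t"
        unfolding a_def using wt_outside_window[OF False] st N
        by (intro mult_right_mono powr_mono2') auto
      finally show ?thesis
        using False mult_right_mono[of "wt j powr s" "a * wt j powr t" "cmod (u j)"]
        by (simp add: restr_def norm_mult a_def)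
    qed (simp add: restr_def)
  qed
qed

text \<open>A Bernstein inequality for trigonometric polynomials: on the window no weight exceeds
  \<open>N\<close>.\<close>

lemma inverse_inequality:
  assumes e: "l2_le e B" and ran: "e \<in> ranPN N" and s: "s \<ge> 0" and N: "N \<ge> 1"
  shows "l2_le (weighted s e) (real N powr s * B)"
proof -
  have "l2_le (\<lambda>j. complex_of_real (real N powr s) * e j) (cmod (complex_of_real (real N powr s)) * B)"
    by (rule l2_le_cmult[OF e])
  also have "cmod (complex_of_real (real N powr s)) = real N powr s" by simp
  finally show ?thesis
  proof (rule l2_le_dominated)
    fix j
    show "cmod (weighted s e j) \<le> cmod (complex_of_real (real N powr s) * e j)"
    proof (cases "j \<in> {-Nminus N..Nplus N}")
      case True
      have "wt j powr s \<le> real N powr s"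
        using wt_inside_window[OF True N] s by (intro powr_mono2) auto
      then show ?thesis by (simp add: norm_mult mult_right_mono)
    next
      case False
      then have "e j = 0" using ran by (auto simp: ranPN_eq)
      then show ?thesis by simp
    qed
  qed
qed

text \<open>Consistency error. Subtracting the projected exact equation cancels the jump data, and
  the projection removes the nonnegative tail of \<open>u\<close>; only the tail fed through
  \<open>g\<close> and \<open>Cminus\<close> remains.\<close>

lemma AN_error:
  assumes g: "in_l1 g" and u: "RHP_sol g u" "l2_le u U" and uN: "uN \<in> ranPN N" "AN N g uN = PN N (g - one_c)"
    and \<rho>: "l2_le (restr (- {-Nminus N..Nplus N}) u) R"
  shows "l2_le (AN N g (\<lambda>j. uN j - PN N u j)) (l1_norm g * R)"
proof (rule l2_le_dominated[OF l2_le_Mult[OF g l2_le_Cminus[OF \<rho>]]])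
  fix j
  let ?r = "restr (- {-Nminus N..Nplus N}) u"
  have Pu: "PN N u \<in> ranPN N" by (simp add: ranPN_def)
  have Pul: "l2_le (PN N u) U" unfolding PN_eq_restr by (rule l2_le_restr[OF u(2)])
  have nPu: "(\<lambda>j. (-1) * PN N u j) \<in> ranPN N" using Pu by (auto simp: ranPN_eq)
  have "AN N g (\<lambda>j. uN j - PN N u j) j = AN N g uN j - AN N g (PN N u) j"
    using AN_add[OF g uN(1) nPu, of j] AN_cmult[OF Pu, of g "-1" j] by simp
  moreover have "AN N g uN j - AN N g (PN N u) j = - Mult g (Cminus ?r) j"
    if j: "j \<in> {-Nminus N..Nplus N}"
  proof -
    have "AN N g uN j = g j - one_c j" using j unfolding uN(2) by (simp add: PN_def)
    also have "\<dots> = Cplus u j - Mult g (Cminus u) j"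
      using u(1) unfolding RHP_sol_def by (metis minus_apply)
    also have "Mult g (Cminus u) j = Mult g (Cminus (PN N u)) j + Mult g (Cminus ?r) j"
      using Mult_Cminus_add[OF g Pul \<rho>, of j] unfolding PN_eq_restr restr_split .
    finally have "AN N g uN j = Cplus u j - (Mult g (Cminus (PN N u)) j + Mult g (Cminus ?r) j)" .
    moreover have "AN N g (PN N u) j = Cplus u j - Mult g (Cminus (PN N u)) j"
    proof -
      have "Cplus (PN N u) j = Cplus u j" using j by (simp add: Cplus_def PN_def)
      then show ?thesis using j by (simp add: AN_apply[OF Pu])
    qed
    ultimately show ?thesis by simp
  qed
  moreover have "AN N g uN j - AN N g (PN N u) j = 0" if "j \<notin> {-Nminus N..Nplus N}"
    unfolding AN_apply[OF Pu] AN_apply[OF uN(1)] if_not_P[OF that] by simp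
  ultimately show "cmod (AN N g (\<lambda>j. uN j - PN N u j) j) \<le> cmod (Mult g (Cminus ?r) j)"
    by (cases "j \<in> {-Nminus N..Nplus N}") auto
qed

theorem theoremt:
  fixes c :: "real \<Rightarrow> real" and g u :: lcoef and t :: real
  assumes c_pos: "\<forall>r\<ge>0. c r > 0"
    and t: "t \<ge> 1"
    and gH: "in_Hs t g"
    and gmin: "\<exists>\<delta>>0. \<forall>z. cmod z = 1 \<longrightarrow> cmod (lval g z) \<ge> \<delta>"
    and uH: "in_Hs t u"
    and usol: "RHP_sol g u"
    and uniq: "\<forall>v. RHP_sol g v \<longrightarrow> v = u"
  shows "\<forall>s. (s = 0 \<or> s > 1/2) \<and> 0 \<le> 2 * s \<and> 2 * s < t \<longrightarrow>
           (\<exists>Cst. \<exists>N0>0. \<forall>N::nat. real N > N0 \<longrightarrow>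
              bij_betw (AN N g) (ranPN N) (ranPN N) \<and>
              (\<forall>uN \<in> ranPN N. AN N g uN = PN N (g - one_c) \<longrightarrow>
                  Hs_norm c s (u - uN) \<le> Cst * real N powr (s - t)))"
proof (intro allI impI)
  fix s assume "(s = 0 \<or> s > 1/2) \<and> 0 \<le> 2 * s \<and> 2 * s < t"
  then have s: "0 \<le> s" "s \<le> t" by auto
  have g: "in_l1 g" and ul: "in_l1 u"
    using in_Hs_imp_in_l1[OF t] gH uH by auto
  obtain d where d: "d > 0" "\<And>z. cmod z = 1 \<Longrightarrow> cmod (lval g z) \<ge> d" using gmin by blast
  obtain \<kappa> N1 where \<kappa>: "\<kappa> > 0"
    and stable: "\<And>N v B. N \<ge> N1 \<Longrightarrow> v \<in> ranPN N \<Longrightarrow> l2_le (AN N g v) B \<Longrightarrow> l2_le v (\<kappa> * B)"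
    using AN_stable[OF g d usol ul uniq] by blast
  obtain U where U: "l2_le (weighted t u) U" using in_Hs_imp_l2_le[OF uH] by blast
  obtain U0 where U0: "l2_le u U0"
    using usol in_Hs_imp_l2_le[of 0 u] unfolding RHP_sol_def weighted_0 by blast
  \<comment> \<open>The first summand bounds the tail of \<open>u\<close> outside the window, the
    second the distance from \<open>uN\<close> to \<open>PN N u\<close>. The powers of
    \<open>1/2\<close> stem from the bound \<open>N / 2\<close> on the outer weights.\<close>
  define Cst where "Cst = sqrt (c \<bar>s\<bar>) * ((1/2) powr (s - t) * U + \<kappa> * (l1_norm g * ((1/2) powr (- t) * U)))"
  show "\<exists>Cst. \<exists>N0>0. \<forall>N::nat. real N > N0 \<longrightarrow>
              bij_betw (AN N g) (ranPN N) (ranPN N) \<and>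
              (\<forall>uN \<in> ranPN N. AN N g uN = PN N (g - one_c) \<longrightarrow>
                  Hs_norm c s (u - uN) \<le> Cst * real N powr (s - t))"
  proof (rule exI[of _ Cst], rule exI[of _ "real N1 + 1"], intro conjI allI impI ballI)
    show "real N1 + 1 > 0" by simp
    fix N :: nat assume "real N > real N1 + 1"
    then have N: "N \<ge> N1" "N \<ge> 1" by auto
    show "bij_betw (AN N g) (ranPN N) (ranPN N)"
    proof (rule AN_bij[OF g])
      fix v j assume v: "v \<in> ranPN N" "\<And>j. AN N g v j = 0"
      \<comment> \<open>Stability with bound \<open>0\<close> is injectivity.\<close>
      have "l2_le (AN N g v) 0" using v(2) by (simp add: l2_le_def L2_set_def)
      from l2_le_bound[OF stable[OF N(1) v(1) this], of j] show "v j = 0" by simp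
    qed
    fix uN assume uN: "uN \<in> ranPN N" "AN N g uN = PN N (g - one_c)"
    define e where "e j = uN j - PN N u j" for j
    define \<rho> where "\<rho> = restr (- {-Nminus N..Nplus N}) u"
    define R where "R = (real N / 2) powr (- t) * U"
    have e: "e \<in> ranPN N" using uN(1) by (auto simp: e_def ranPN_eq PN_def)
    \<comment> \<open>The tail is measured in l2, at the full rate \<open>N powr (- t)\<close>; the
      factor \<open>N powr s\<close> paid below for passing to order \<open>s\<close> still leaves
      the rate \<open>s - t\<close>.\<close>
    have R: "l2_le \<rho> R"
      using truncation_error[OF U, of 0 N] t N(2) unfolding weighted_0 \<rho>_def R_def by simp
    have "l2_le (AN N g e) (l1_norm g * R)"
      unfolding e_def using AN_error[OF g usol U0 uN R[unfolded \<rho>_def]] .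
    then have "l2_le e (\<kappa> * (l1_norm g * R))"
      by (rule stable[OF N(1) e])
    then have es: "l2_le (weighted s e) (real N powr s * (\<kappa> * (l1_norm g * R)))"
      by (rule inverse_inequality[OF _ e s(1) N(2)])
    have \<rho>s: "l2_le (weighted s \<rho>) ((real N / 2) powr (s - t) * U)"
      unfolding \<rho>_def by (rule truncation_error[OF U s(2) N(2)])
    have "l2_le (weighted s (u - uN)) ((real N / 2) powr (s - t) * U + real N powr s * (\<kappa> * (l1_norm g * R)))"
    proof (rule l2_le_add[OF \<rho>s es])
      fix j
      have "(u - uN) j = \<rho> j - e j" by (simp add: \<rho>_def e_def restr_def PN_def)
      then have "cmod (weighted s (u - uN) j) = cmod (weighted s \<rho> j - weighted s e j)"
        by (simp only: right_diff_distrib)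
      then show "cmod (weighted s (u - uN) j) \<le> cmod (weighted s \<rho> j) + cmod (weighted s e j)"
        using norm_triangle_ineq4 by metis
    qed
    moreover have "0 \<le> c \<bar>s\<bar>" using c_pos by (simp add: less_imp_le)
    ultimately have "Hs_norm c s (u - uN) \<le> sqrt (c \<bar>s\<bar>) *
        ((real N / 2) powr (s - t) * U + real N powr s * (\<kappa> * (l1_norm g * R)))"
      by (rule l2_le_imp_Hs_norm)
    also have "(real N / 2) powr (s - t) = (1/2) powr (s - t) * real N powr (s - t)"
      using powr_mult[of "1/2" "real N" "s - t"] by simp
    also have "R = (1/2) powr (- t) * real N powr (- t) * U"
      unfolding R_def using powr_mult[of "1/2" "real N" "- t"] by simp
    also have "sqrt (c \<bar>s\<bar>) * ((1/2) powr (s - t) * real N powr (s - t) * U +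
        real N powr s * (\<kappa> * (l1_norm g * ((1/2) powr (- t) * real N powr (- t) * U)))) =
        sqrt (c \<bar>s\<bar>) * ((1/2) powr (s - t) * U * real N powr (s - t) +
        \<kappa> * (l1_norm g * ((1/2) powr (- t) * U)) * (real N powr s * real N powr (- t)))"
      by (simp only: mult_ac)
    also have "real N powr s * real N powr (- t) = real N powr (s - t)"
      by (simp add: powr_add[symmetric])
    also have "sqrt (c \<bar>s\<bar>) * ((1/2) powr (s - t) * U * real N powr (s - t) +
        \<kappa> * (l1_norm g * ((1/2) powr (- t) * U)) * real N powr (s - t)) = Cst * real N powr (s - t)"
      unfolding Cst_def by (simp only: distrib_right mult.assoc)
    finally show "Hs_norm c s (u - uN) \<le> Cst * real N powr (s - t)" .
  qed
qed

end
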